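(* Let $d,k,p,r$ be integers with $1\le k<d$, $1\le p<d$, $r\ge2$. Let $V=\mathbb{C}^{rd}$ with basis $\{x_1,\dots,x_{rd}\}$ and let $P=x_1\cdots x_d+x_{d+1}\cdots x_{2d}+\cdots+x_{(r-1)d+1}\cdots x_{rd}\in S^dV$. Then the map $$P_{k,d-k}^{\wedge p}:S^kV^*\otimes\Lambda^pV\rightarrow S^{d-k-1}V\otimes\Lambda^{p+1}V$$ satisfies $$\operatorname{rank}(P_{k,d-k}^{\wedge p})\le r\left[\binom{d}{k}\left(\binom{dr}{p}-\binom{d}{p}\right)+\mathbf{S}(p,d,k)\right].$$ In particular, when $d\ge2$ and $p=k=1$, $$\operatorname{rank}(P_{1,d-1}^{\wedge1})\le d^2r^2-r.$$ Therefore the $(d^2r^2-r+1)\times(d^2r^2-r+1)$ minors of the Koszul Young flattening $Q\mapsto Q_{1,d-1}^{\wedge1}$ ($Q\in S^dV$), regarded as polynomials on $S^dV$, are in the ideal of $\sigma_r(Ch_d(V))$.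
   Context: $V$ is a finite-dimensional complex vector space. For $P\in S^dV$ and $1\le k<d$, the flattening $P_{k,d-k}:S^kV^*\to S^{d-k}V$ is the linear map sending a homogeneous degree-$k$ constant-coefficient differential operator $D\in S^kV^*$ to $D(P)$. The Koszul Young flattening $P_{k,d-k}^{\wedge p}:S^kV^*\otimes\Lambda^pV\to S^{d-k-1}V\otimes\Lambda^{p+1}V$ is the composition of $P_{k,d-k}\otimes\mathrm{Id}_{\Lambda^pV}:S^kV^*\otimes\Lambda^pV\to S^{d-k}V\otimes\Lambda^pV$ with the exterior derivative $\wedge_{d-k,p}:S^{d-k}V\otimes\Lambda^pV\to S^{d-k-1}V\otimes\Lambda^{p+1}V$, the linear map given by $l_1\cdots l_{d-k}\otimes m_1\wedge\cdots\wedge m_p\mapsto\sum_{s=1}^{d-k}l_1\cdots\hat{l_s}\cdots l_{d-k}\otimes l_s\wedge m_1\wedge\cdots\wedge m_p$. Minors of this linear map (in fixed bases) are homogeneous polynomials on $S^dV$. The number $\mathbf{S}(p,d,k)$ is $$\mathbf{S}(p,d,k)=\sum_{s=\max\{0,p-k\}}^{\min\{p,d-k-1\}}\binom{d}{s}\binom{d-s}{d-k+p-2s}\binom{d-k+p-2s-1}{p-s}.$$ The Chow variety is $Ch_d(V)=\mathbb{P}\{z\in S^dV\mid z=w_1\cdots w_d\text{ for some }w_i\in V\}\subset\mathbb{P}S^dV$. For a projective variety $X\subset\mathbb{P}U$, its $r$-th secant variety $\sigma_r(X)$ is the Zariski closure of the union of the linear spans $\langle p_1,\dots,p_r\rangle$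 over all $p_1,\dots,p_r\in X$. *)

theory Defs
  imports "HOL-Library.Poly_Mapping" "Jordan_Normal_Form.Determinant"
begin

section \<open>Complex vector spaces with a fixed basis\<close>

text \<open>
  A vector with coordinates in a basis indexed by a set \<open>B\<close> is a finitely supported function
  \<open>'b \<Rightarrow>\<^sub>0 complex\<close> supported in \<open>B\<close>.  With \<open>B\<close> a set of exponent vectors \<open>'a \<Rightarrow>\<^sub>0 nat\<close> the
  multiplication of \<^theory>\<open>HOL-Library.Poly_Mapping\<close> is polynomial multiplication.
\<close>

definition cscale :: "complex \<Rightarrow> ('b \<Rightarrow>\<^sub>0 complex) \<Rightarrow> ('b \<Rightarrow>\<^sub>0 complex)" where
  "cscale c = Poly_Mapping.map ((*) c)"

lemma lookup_cscale [simp]: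
  "Poly_Mapping.lookup (cscale c v) b = c * Poly_Mapping.lookup v b"
  unfolding cscale_def by (simp add: Poly_Mapping.map.rep_eq when_def)

interpretation cvs: vector_space "cscale :: complex \<Rightarrow> ('b \<Rightarrow>\<^sub>0 complex) \<Rightarrow> ('b \<Rightarrow>\<^sub>0 complex)"
  by unfold_locales (auto intro!: poly_mapping_eqI simp: lookup_add algebra_simps)

definition free_vs :: "'b set \<Rightarrow> ('b \<Rightarrow>\<^sub>0 complex) set" where
  "free_vs B = {v. Poly_Mapping.keys v \<subseteq> B}"

definition basis_vec :: "'b \<Rightarrow> ('b \<Rightarrow>\<^sub>0 complex)" where
  "basis_vec b = Poly_Mapping.single b 1"

definition lin_ext :: "('b \<Rightarrow> ('c \<Rightarrow>\<^sub>0 complex)) \<Rightarrow> ('b \<Rightarrow>\<^sub>0 complex) \<Rightarrow> ('c \<Rightarrow>\<^sub>0 complex)" where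
  "lin_ext g v = (\<Sum>b\<in>Poly_Mapping.keys v. cscale (Poly_Mapping.lookup v b) (g b))"

definition lin_rank :: "(('b \<Rightarrow>\<^sub>0 complex) \<Rightarrow> ('c \<Rightarrow>\<^sub>0 complex)) \<Rightarrow> ('b \<Rightarrow>\<^sub>0 complex) set \<Rightarrow> nat" where
  "lin_rank f U = cvs.dim (f ` U)"

definition tensor :: "('b \<Rightarrow>\<^sub>0 complex) \<Rightarrow> ('c \<Rightarrow>\<^sub>0 complex) \<Rightarrow> ('b \<times> 'c \<Rightarrow>\<^sub>0 complex)" where
  "tensor u v = (\<Sum>a\<in>Poly_Mapping.keys u. \<Sum>b\<in>Poly_Mapping.keys v.
     Poly_Mapping.single (a, b) (Poly_Mapping.lookup u a * Poly_Mapping.lookup v b))"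

definition tensor_map ::
  "(('a \<Rightarrow>\<^sub>0 complex) \<Rightarrow> ('c \<Rightarrow>\<^sub>0 complex)) \<Rightarrow> (('b \<Rightarrow>\<^sub>0 complex) \<Rightarrow> ('d \<Rightarrow>\<^sub>0 complex)) \<Rightarrow>
   ('a \<times> 'b \<Rightarrow>\<^sub>0 complex) \<Rightarrow> ('c \<times> 'd \<Rightarrow>\<^sub>0 complex)" where
  "tensor_map f g = lin_ext (\<lambda>(a, b). tensor (f (basis_vec a)) (g (basis_vec b)))"


section \<open>Symmetric and exterior powers of \<open>V = \<complex>\<^sup>n\<close>\<close>

definition exps :: "'a set \<Rightarrow> nat \<Rightarrow> ('a \<Rightarrow>\<^sub>0 nat) set" where
  "exps A d = {m. Poly_Mapping.keys m \<subseteq> A \<and>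
     (\<Sum>a\<in>Poly_Mapping.keys m. Poly_Mapping.lookup m a) = d}"

definition subsets_of_card :: "nat \<Rightarrow> nat \<Rightarrow> nat set set" where
  "subsets_of_card n p = {S. S \<subseteq> {1..n} \<and> card S = p}"

definition Vsp :: "nat \<Rightarrow> (nat \<Rightarrow>\<^sub>0 complex) set" where
  "Vsp n = free_vs {1..n}"

text \<open>
  The same set of polynomials also serves as \<open>S\<^sup>d V\<^sup>*\<close>, written in the dual basis of \<open>V\<^sup>*\<close>, that is,
  in the partial derivatives.
\<close>

definition Sym :: "nat \<Rightarrow> nat \<Rightarrow> ((nat \<Rightarrow>\<^sub>0 nat) \<Rightarrow>\<^sub>0 complex) set" where
  "Sym n d = free_vs (exps {1..n} d)"

definition lin_form :: "(nat \<Rightarrow>\<^sub>0 complex) \<Rightarrow> ((nat \<Rightarrow>\<^sub>0 nat) \<Rightarrow>\<^sub>0 complex)" where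
  "lin_form = lin_ext (\<lambda>i. basis_vec (Poly_Mapping.single i 1))"

definition sym_var :: "nat \<Rightarrow> ((nat \<Rightarrow>\<^sub>0 nat) \<Rightarrow>\<^sub>0 complex)" where
  "sym_var i = lin_form (basis_vec i)"

text \<open>
  \<open>S = {j\<^sub>1 < \<dots> < j\<^sub>p}\<close> stands for the basis vector \<open>x\<^bsub>j\<^sub>1\<^esub> \<and> \<dots> \<and> x\<^bsub>j\<^sub>p\<^esub>\<close>.
\<close>

definition wedge_basis :: "nat \<Rightarrow> nat set \<Rightarrow> (nat set \<Rightarrow>\<^sub>0 complex)" where
  "wedge_basis i S =
     (if i \<in> S then 0 else Poly_Mapping.single (insert i S) ((-1) ^ card {j \<in> S. j < i}))"

definition wedge_left :: "(nat \<Rightarrow>\<^sub>0 complex) \<Rightarrow> (nat set \<Rightarrow>\<^sub>0 complex) \<Rightarrow> (nat set \<Rightarrow>\<^sub>0 complex)" where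
  "wedge_left v w = lin_ext (\<lambda>i. lin_ext (wedge_basis i) w) v"

definition wedge_list :: "(nat \<Rightarrow>\<^sub>0 complex) list \<Rightarrow> (nat set \<Rightarrow>\<^sub>0 complex)" where
  "wedge_list ms = foldr wedge_left ms (basis_vec {})"

definition sym_ext_basis :: "nat \<Rightarrow> nat \<Rightarrow> nat \<Rightarrow> ((nat \<Rightarrow>\<^sub>0 nat) \<times> nat set) set" where
  "sym_ext_basis n a p = exps {1..n} a \<times> subsets_of_card n p"

definition SymExt :: "nat \<Rightarrow> nat \<Rightarrow> nat \<Rightarrow> ((nat \<Rightarrow>\<^sub>0 nat) \<times> nat set \<Rightarrow>\<^sub>0 complex) set" where
  "SymExt n a p = free_vs (sym_ext_basis n a p)"


section \<open>Koszul Young flattenings\<close>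

definition partial ::
  "nat \<Rightarrow> ((nat \<Rightarrow>\<^sub>0 nat) \<Rightarrow>\<^sub>0 complex) \<Rightarrow> ((nat \<Rightarrow>\<^sub>0 nat) \<Rightarrow>\<^sub>0 complex)" where
  "partial i = lin_ext (\<lambda>m. Poly_Mapping.single (m - Poly_Mapping.single i 1)
     (of_nat (Poly_Mapping.lookup m i)))"

definition diff_monom ::
  "(nat \<Rightarrow>\<^sub>0 nat) \<Rightarrow> ((nat \<Rightarrow>\<^sub>0 nat) \<Rightarrow>\<^sub>0 complex) \<Rightarrow> ((nat \<Rightarrow>\<^sub>0 nat) \<Rightarrow>\<^sub>0 complex)" where
  "diff_monom g P = foldr (\<lambda>i. partial i ^^ Poly_Mapping.lookup g i)
     (sorted_list_of_set (Poly_Mapping.keys g)) P"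

text \<open>
  The degree \<open>k\<close> enters only through the domain \<open>Sym n k\<close>, on which \<open>flattening P\<close> is
  the map \<open>D \<mapsto> D(P)\<close>; similarly for \<open>ext_deriv\<close> and \<open>koszul\<close> below.
\<close>

definition flattening ::
  "((nat \<Rightarrow>\<^sub>0 nat) \<Rightarrow>\<^sub>0 complex) \<Rightarrow> ((nat \<Rightarrow>\<^sub>0 nat) \<Rightarrow>\<^sub>0 complex) \<Rightarrow> ((nat \<Rightarrow>\<^sub>0 nat) \<Rightarrow>\<^sub>0 complex)" where
  "flattening P = lin_ext (\<lambda>g. diff_monom g P)"

text \<open>
  On \<open>x\<^sup>m \<otimes> x\<^sub>S\<close> each of the \<open>m i\<close> factors \<open>x\<^sub>i\<close> of \<open>x\<^sup>m\<close> contributes the same summand.  The defining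
  formula on arbitrary products of vectors is lemma \<open>ext_deriv_decomposable\<close>.
\<close>

definition ext_deriv ::
  "((nat \<Rightarrow>\<^sub>0 nat) \<times> nat set \<Rightarrow>\<^sub>0 complex) \<Rightarrow> ((nat \<Rightarrow>\<^sub>0 nat) \<times> nat set \<Rightarrow>\<^sub>0 complex)" where
  "ext_deriv = lin_ext (\<lambda>(m, S). \<Sum>i\<in>Poly_Mapping.keys m.
     cscale (of_nat (Poly_Mapping.lookup m i))
       (tensor (basis_vec (m - Poly_Mapping.single i 1)) (wedge_left (basis_vec i) (basis_vec S))))"

definition koszul ::
  "((nat \<Rightarrow>\<^sub>0 nat) \<Rightarrow>\<^sub>0 complex) \<Rightarrow>
   ((nat \<Rightarrow>\<^sub>0 nat) \<times> nat set \<Rightarrow>\<^sub>0 complex) \<Rightarrow> ((nat \<Rightarrow>\<^sub>0 nat) \<times> nat set \<Rightarrow>\<^sub>0 complex)" where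
  "koszul P = ext_deriv \<circ> tensor_map (flattening P) id"

definition koszul_rank :: "nat \<Rightarrow> nat \<Rightarrow> nat \<Rightarrow> ((nat \<Rightarrow>\<^sub>0 nat) \<Rightarrow>\<^sub>0 complex) \<Rightarrow> nat" where
  "koszul_rank n k p P = lin_rank (koszul P) (SymExt n k p)"

text \<open>
  For \<open>1 \<le> k < d\<close> and \<open>1 \<le> p < d\<close>, the only truncated subtraction that is ever cut off at \<open>0\<close> is the lower
  summation bound \<open>p - k\<close>, which is thereby \<open>max {0, p - k}\<close>.
\<close>

definition S_num :: "nat \<Rightarrow> nat \<Rightarrow> nat \<Rightarrow> nat" where
  "S_num p d k = (\<Sum>s = p - k..min p (d - k - 1).
     (d choose s) * ((d - s) choose (d - k + p - 2 * s)) *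
     ((d - k + p - 2 * s - 1) choose (p - s)))"

definition sum_of_products :: "nat \<Rightarrow> nat \<Rightarrow> ((nat \<Rightarrow>\<^sub>0 nat) \<Rightarrow>\<^sub>0 complex)" where
  "sum_of_products r d = (\<Sum>j<r. \<Prod>i = 1..d. sym_var (j * d + i))"


section \<open>Projective varieties\<close>

text \<open>
  Points of the projective space of \<open>free_vs B\<close> are the lines through the origin.
\<close>

definition proj_space :: "'b set \<Rightarrow> ('b \<Rightarrow>\<^sub>0 complex) set set" where
  "proj_space B = {cvs.span {z} |z. z \<in> free_vs B \<and> z \<noteq> 0}"

text \<open>
  Polynomials on \<open>free_vs B\<close> have one variable for each \<open>b \<in> B\<close>, the coordinate
  function \<open>\<lambda>z. lookup z b\<close>.
\<close>

definition poly_ring :: "'b set \<Rightarrow> (('b \<Rightarrow>\<^sub>0 nat) \<Rightarrow>\<^sub>0 complex) set" where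
  "poly_ring B = free_vs {m. Poly_Mapping.keys m \<subseteq> B}"

definition peval :: "(('b \<Rightarrow>\<^sub>0 nat) \<Rightarrow>\<^sub>0 complex) \<Rightarrow> ('b \<Rightarrow>\<^sub>0 complex) \<Rightarrow> complex" where
  "peval F z = (\<Sum>m\<in>Poly_Mapping.keys F. Poly_Mapping.lookup F m *
     (\<Prod>b\<in>Poly_Mapping.keys m. Poly_Mapping.lookup z b ^ Poly_Mapping.lookup m b))"

definition zero_locus ::
  "'b set \<Rightarrow> (('b \<Rightarrow>\<^sub>0 nat) \<Rightarrow>\<^sub>0 complex) set \<Rightarrow> ('b \<Rightarrow>\<^sub>0 complex) set set" where
  "zero_locus B Fs = {L \<in> proj_space B. \<forall>F\<in>Fs. \<forall>z\<in>L. peval F z = 0}"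

definition zariski_closed :: "'b set \<Rightarrow> ('b \<Rightarrow>\<^sub>0 complex) set set \<Rightarrow> bool" where
  "zariski_closed B Z \<longleftrightarrow> (\<exists>Fs. Fs \<subseteq> (\<Union>e. free_vs (exps B e)) \<and> Z = zero_locus B Fs)"

definition zariski_closure ::
  "'b set \<Rightarrow> ('b \<Rightarrow>\<^sub>0 complex) set set \<Rightarrow> ('b \<Rightarrow>\<^sub>0 complex) set set" where
  "zariski_closure B X = \<Inter>{Z. zariski_closed B Z \<and> X \<subseteq> Z}"

definition vanishing_ideal ::
  "'b set \<Rightarrow> ('b \<Rightarrow>\<^sub>0 complex) set set \<Rightarrow> (('b \<Rightarrow>\<^sub>0 nat) \<Rightarrow>\<^sub>0 complex) set" where
  "vanishing_ideal B X = {F \<in> poly_ring B. \<forall>L\<in>X. \<forall>z\<in>L. peval F z = 0}"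

definition proj_span ::
  "'b set \<Rightarrow> ('b \<Rightarrow>\<^sub>0 complex) set set \<Rightarrow> ('b \<Rightarrow>\<^sub>0 complex) set set" where
  "proj_span B Y = {L \<in> proj_space B. L \<subseteq> cvs.span (\<Union>Y)}"

definition secant_variety ::
  "'b set \<Rightarrow> nat \<Rightarrow> ('b \<Rightarrow>\<^sub>0 complex) set set \<Rightarrow> ('b \<Rightarrow>\<^sub>0 complex) set set" where
  "secant_variety B r X =
     zariski_closure B (\<Union>ps\<in>{ps. length ps = r \<and> set ps \<subseteq> X}. proj_span B (set ps))"

definition Chow :: "nat \<Rightarrow> nat \<Rightarrow> ((nat \<Rightarrow>\<^sub>0 nat) \<Rightarrow>\<^sub>0 complex) set set" where
  "Chow n d = {cvs.span {z} |z. z \<in> Sym n d \<and> z \<noteq> 0 \<and>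
     (\<exists>w. (\<forall>i<d. w i \<in> Vsp n) \<and> z = (\<Prod>i<d. lin_form (w i)))}"


section \<open>Minors of the Koszul Young flattening as polynomials on \<open>S\<^sup>d V\<close>\<close>

definition koszul_entry ::
  "((nat \<Rightarrow>\<^sub>0 nat) \<Rightarrow>\<^sub>0 complex) \<Rightarrow> (nat \<Rightarrow>\<^sub>0 nat) \<times> nat set \<Rightarrow> (nat \<Rightarrow>\<^sub>0 nat) \<times> nat set \<Rightarrow> complex" where
  "koszul_entry Q b c = Poly_Mapping.lookup (koszul Q (basis_vec c)) b"

text \<open>
  \<open>koszul_entry Q b c\<close> is linear in \<open>Q\<close>; as a polynomial in the coordinates of \<open>Q \<in> Sym n d\<close> it is
  the following linear form (lemmas \<open>peval_koszul_entry_poly\<close> and \<open>peval_koszul_minor\<close>).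
\<close>

definition koszul_entry_poly ::
  "nat \<Rightarrow> nat \<Rightarrow> (nat \<Rightarrow>\<^sub>0 nat) \<times> nat set \<Rightarrow> (nat \<Rightarrow>\<^sub>0 nat) \<times> nat set \<Rightarrow>
   (((nat \<Rightarrow>\<^sub>0 nat) \<Rightarrow>\<^sub>0 nat) \<Rightarrow>\<^sub>0 complex)" where
  "koszul_entry_poly n d b c = (\<Sum>m\<in>exps {1..n} d.
     Poly_Mapping.single (Poly_Mapping.single m 1) (koszul_entry (basis_vec m) b c))"

definition koszul_minor ::
  "nat \<Rightarrow> nat \<Rightarrow> ((nat \<Rightarrow>\<^sub>0 nat) \<times> nat set) list \<Rightarrow> ((nat \<Rightarrow>\<^sub>0 nat) \<times> nat set) list \<Rightarrow>
   (((nat \<Rightarrow>\<^sub>0 nat) \<Rightarrow>\<^sub>0 nat) \<Rightarrow>\<^sub>0 complex)" where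
  "koszul_minor n d bs cs = det (mat (length bs) (length cs)
     (\<lambda>(i, j). koszul_entry_poly n d (bs ! i) (cs ! j)))"

definition koszul_minors ::
  "nat \<Rightarrow> nat \<Rightarrow> nat \<Rightarrow> nat \<Rightarrow> nat \<Rightarrow> (((nat \<Rightarrow>\<^sub>0 nat) \<Rightarrow>\<^sub>0 nat) \<Rightarrow>\<^sub>0 complex) set" where
  "koszul_minors n d k p N = {koszul_minor n d bs cs |bs cs.
     length bs = N \<and> distinct bs \<and> set bs \<subseteq> sym_ext_basis n (d - k - 1) (p + 1) \<and>
     length cs = N \<and> distinct cs \<and> set cs \<subseteq> sym_ext_basis n k p}"


section \<open>Consistency of the definitions\<close>

abbreviation lin :: "(('b \<Rightarrow>\<^sub>0 complex) \<Rightarrow> ('c \<Rightarrow>\<^sub>0 complex)) \<Rightarrow> bool" where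
  "lin \<equiv> Vector_Spaces.linear cscale cscale"

lemma linI:
  assumes "\<And>u v. F (u + v) = F u + F v" "\<And>c v. F (cscale c v) = cscale c (F v)"
  shows "lin F"
  using assms by (intro Vector_Spaces.linear.intro module_hom.intro cvs.vector_space_axioms
     module_hom_axioms.intro cvs.module_axioms)

lemma lin_add: "lin F \<Longrightarrow> F (u + v) = F u + F v"
  and lin_scale: "lin F \<Longrightarrow> F (cscale c v) = cscale c (F v)"
  and lin_sum: "lin F \<Longrightarrow> F (sum h I) = (\<Sum>i\<in>I. F (h i))"
  and lin_zero: "lin F \<Longrightarrow> F 0 = 0"
  by (auto simp: Vector_Spaces.linear_iff_module_hom module_hom.add module_hom.scale
      module_hom.sum module_hom.zero)

lemma single_conv_basis_vec: "Poly_Mapping.single b c = cscale c (basis_vec b)"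
  by (rule poly_mapping_eqI) (simp add: basis_vec_def lookup_single when_def)

lemma basis_expansion:
  "v = (\<Sum>b\<in>Poly_Mapping.keys v. cscale (Poly_Mapping.lookup v b) (basis_vec b))"
proof (rule poly_mapping_eqI)
  fix k
  show "Poly_Mapping.lookup v k = Poly_Mapping.lookup
    (\<Sum>b\<in>Poly_Mapping.keys v. cscale (Poly_Mapping.lookup v b) (basis_vec b)) k"
    by (simp add: lookup_sum basis_vec_def lookup_single when_def in_keys_iff if_distrib cong: if_cong)
qed

lemma lin_ext_superset:
  assumes "finite A" "Poly_Mapping.keys v \<subseteq> A"
  shows "lin_ext g v = (\<Sum>b\<in>A. cscale (Poly_Mapping.lookup v b) (g b))"
  unfolding lin_ext_def using assms
  by (intro sum.mono_neutral_left) (auto simp: in_keys_iff)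

lemma lin_ext_lin: "lin (lin_ext g)"
proof (rule linI)
  fix u v :: "'a \<Rightarrow>\<^sub>0 complex" and c
  let ?A = "Poly_Mapping.keys u \<union> Poly_Mapping.keys v"
  have "lin_ext g (u + v) = (\<Sum>b\<in>?A. cscale (Poly_Mapping.lookup (u + v) b) (g b))"
    by (rule lin_ext_superset) (use keys_add[of u v] in auto)
  also have "\<dots> = (\<Sum>b\<in>?A. cscale (Poly_Mapping.lookup u b) (g b)) +
      (\<Sum>b\<in>?A. cscale (Poly_Mapping.lookup v b) (g b))"
    by (simp add: lookup_add cvs.scale_left_distrib sum.distrib)
  also have "\<dots> = lin_ext g u + lin_ext g v"
    by (simp add: lin_ext_superset[of ?A])
  finally show "lin_ext g (u + v) = lin_ext g u + lin_ext g v" .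
  have "lin_ext g (cscale c v) = (\<Sum>b\<in>Poly_Mapping.keys v. cscale (Poly_Mapping.lookup (cscale c v) b) (g b))"
    by (rule lin_ext_superset) (auto simp: in_keys_iff)
  then show "lin_ext g (cscale c v) = cscale c (lin_ext g v)"
    by (simp add: lin_ext_def cvs.scale_sum_right)
qed

lemma lin_ext_basis [simp]: "lin_ext g (basis_vec b) = g b"
  by (simp add: lin_ext_def basis_vec_def)

lemma lin_eq_on_basis:
  assumes "lin F" "lin G" "\<And>b. F (basis_vec b) = G (basis_vec b)"
  shows "F v = G v"
  by (subst (1 2) basis_expansion) (simp add: lin_sum lin_scale assms)

lemma lin_compose: "lin F \<Longrightarrow> lin G \<Longrightarrow> lin (\<lambda>v. F (G v))"
  by (auto intro!: linI simp: lin_add lin_scale)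

lemma lin_plus: "lin F \<Longrightarrow> lin G \<Longrightarrow> lin (\<lambda>v. F v + G v)"
  by (auto intro!: linI simp: lin_add lin_scale cvs.scale_right_distrib algebra_simps)

lemma lin_neg: "lin F \<Longrightarrow> lin (\<lambda>v. - F v)"
  by (auto intro!: linI simp: lin_add lin_scale)

lemma lin_id: "lin (\<lambda>v. v)"
  by (auto intro!: linI)

lemma lin_const_zero: "lin (\<lambda>v. 0)"
  by (auto intro!: linI)

lemma lin_ext_lin_param: "(\<And>b. lin (\<lambda>v. g b v)) \<Longrightarrow> lin (\<lambda>v. lin_ext (\<lambda>b. g b v) u)"
  by (auto intro!: linI simp: lin_ext_def lin_add lin_scale cvs.scale_right_distrib sum.distrib
      cvs.scale_sum_right mult.commute)

lemma tensor_alt: "tensor u v = lin_ext (\<lambda>a. lin_ext (\<lambda>b. basis_vec (a, b)) v) u"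
  by (simp add: tensor_def lin_ext_def cvs.scale_sum_right single_conv_basis_vec)

lemma tensor_basis [simp]: "tensor (basis_vec a) (basis_vec b) = basis_vec (a, b)"
  by (simp add: tensor_alt)

lemma tensor_lin_left: "lin (\<lambda>u. tensor u v)"
  unfolding tensor_alt by (rule lin_ext_lin)

lemma tensor_lin_right: "lin (tensor u)"
  unfolding tensor_alt by (intro lin_ext_lin_param lin_ext_lin)

lemma wedge_left_lin_left: "lin (\<lambda>v. wedge_left v w)"
  unfolding wedge_left_def by (rule lin_ext_lin)

lemma wedge_left_lin_right: "lin (wedge_left v)"
  unfolding wedge_left_def by (intro lin_ext_lin_param lin_ext_lin)

lemma wedge_left_basis [simp]: "wedge_left (basis_vec i) (basis_vec S) = wedge_basis i S"
  by (simp add: wedge_left_def)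

lemma mult_lin_left: "lin (\<lambda>f. f * (h :: ('a :: comm_monoid_add) \<Rightarrow>\<^sub>0 complex))"
proof (rule linI)
  fix c and v :: "'a \<Rightarrow>\<^sub>0 complex"
  show "cscale c v * h = cscale c (v * h)"
    unfolding cscale_def mult_map_scale_conv_mult by (simp add: mult.assoc)
qed (rule distrib_right)

lemma mult_lin_right: "lin (\<lambda>f. (h :: ('a :: comm_monoid_add) \<Rightarrow>\<^sub>0 complex) * f)"
  using mult_lin_left[of h] by (simp add: mult.commute)

lemma basis_vec_mult: "basis_vec a * basis_vec b = basis_vec (a + b)"
  by (simp add: basis_vec_def mult_single)

lemma wedge_left_anticommute_basis:
  assumes "finite S"
  shows "wedge_left (basis_vec i) (wedge_basis j S) = - wedge_left (basis_vec j) (wedge_basis i S)"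
proof -
  have c: "{k. (k = j \<or> k \<in> S) \<and> k < i} =
      (if j < i then insert j {k\<in>S. k < i} else {k\<in>S. k < i})" for i j
    by auto
  have w: "wedge_left (basis_vec i) (Poly_Mapping.single T c) = cscale c (wedge_basis i T)" for i T c
    by (simp add: single_conv_basis_vec lin_scale[OF wedge_left_lin_right])
  show ?thesis
    using assms
    by (cases i j rule: linorder_cases)
      (auto simp: wedge_basis_def w c lin_zero[OF wedge_left_lin_right] insert_commute
        intro!: poly_mapping_eqI simp: lookup_single when_def)
qed

lemma wedge_left_self_basis:
  assumes "finite S"
  shows "wedge_left v (wedge_left v (basis_vec S)) = 0"
proof -
  let ?K = "Poly_Mapping.keys v" and ?c = "Poly_Mapping.lookup v"
  define W where "W i j = wedge_left (basis_vec i) (wedge_basis j S)" for i j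
  have W: "W i j = - W j i" for i j
    unfolding W_def by (rule wedge_left_anticommute_basis[OF assms])
  have left: "wedge_left v u = (\<Sum>i\<in>?K. cscale (?c i) (wedge_left (basis_vec i) u))" for u
    by (subst basis_expansion[of v]) (simp add: lin_sum[OF wedge_left_lin_left] lin_scale[OF wedge_left_lin_left])
  have X: "wedge_left v (wedge_left v (basis_vec S)) =
      (\<Sum>i\<in>?K. \<Sum>j\<in>?K. cscale (?c i * ?c j) (W i j))" (is "?X = ?Y")
    unfolding left[of "basis_vec S"] lin_sum[OF wedge_left_lin_right] lin_scale[OF wedge_left_lin_right]
      left[of "wedge_left _ _"]
    by (subst sum.swap) (simp add: cvs.scale_sum_right W_def mult.commute)
  also have "\<dots> = (\<Sum>j\<in>?K. \<Sum>i\<in>?K. cscale (?c i * ?c j) (W i j))"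
    by (rule sum.swap)
  also have "\<dots> = - ?Y"
    by (subst W) (simp add: sum_negf mult.commute)
  finally have "?X = - ?X"
    using X by simp
  then have "Poly_Mapping.lookup ?X k = - Poly_Mapping.lookup ?X k" for k
    by (metis lookup_uminus)
  then show ?thesis
    by (intro poly_mapping_eqI) simp
qed

lemma wedge_left_self:
  assumes "\<And>S. S \<in> Poly_Mapping.keys w \<Longrightarrow> finite S"
  shows "wedge_left v (wedge_left v w) = 0"
  by (subst basis_expansion[of w])
    (simp add: lin_sum[OF wedge_left_lin_right] lin_scale[OF wedge_left_lin_right]
      wedge_left_self_basis assms)

definition sym_mult :: "((nat \<Rightarrow>\<^sub>0 nat) \<Rightarrow>\<^sub>0 complex) \<Rightarrow>
    ((nat \<Rightarrow>\<^sub>0 nat) \<times> nat set \<Rightarrow>\<^sub>0 complex) \<Rightarrow> ((nat \<Rightarrow>\<^sub>0 nat) \<times> nat set \<Rightarrow>\<^sub>0 complex)" where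
  "sym_mult h = lin_ext (\<lambda>b. tensor (h * basis_vec (fst b)) (basis_vec (snd b)))"

lemma sym_mult_lin_left: "lin (\<lambda>h. sym_mult h u)"
  unfolding sym_mult_def
  by (intro lin_ext_lin_param lin_compose[OF tensor_lin_left] mult_lin_left)

lemma sym_mult_lin_right: "lin (sym_mult h)"
  unfolding sym_mult_def by (rule lin_ext_lin)

lemma sym_mult_tensor: "sym_mult h (tensor f w) = tensor (h * f) w"
proof -
  have "sym_mult h (tensor f (basis_vec S)) = tensor (h * f) (basis_vec S)" for S
    by (rule lin_eq_on_basis[where v = f],
        rule lin_compose[OF sym_mult_lin_right tensor_lin_left],
        rule lin_compose[OF tensor_lin_left mult_lin_right],
        simp add: sym_mult_def)
  then show ?thesis
    by (rule lin_eq_on_basis[where v = w,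
        OF lin_compose[OF sym_mult_lin_right tensor_lin_right] tensor_lin_right])
qed

lemma ext_deriv_lin: "lin ext_deriv"
  unfolding ext_deriv_def by (rule lin_ext_lin)

lemma lin_form_lin: "lin lin_form"
  unfolding lin_form_def by (rule lin_ext_lin)

lemma ext_deriv_leibniz_basis:
  "ext_deriv (basis_vec (Poly_Mapping.single i 1 + m, S)) =
     tensor (basis_vec m) (wedge_basis i S) +
     sym_mult (basis_vec (Poly_Mapping.single i 1)) (ext_deriv (basis_vec (m, S)))"
proof -
  define m' where "m' = Poly_Mapping.single i 1 + m"
  define T where "T j = tensor (basis_vec (m' - Poly_Mapping.single j 1)) (wedge_basis j S)" for j
  let ?K = "insert i (Poly_Mapping.keys m)"
  have lk: "Poly_Mapping.lookup m' j = (if j = i then 1 else 0) + Poly_Mapping.lookup m j" for j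
    by (simp add: m'_def lookup_add lookup_single when_def)
  have "ext_deriv (basis_vec (m', S)) =
      (\<Sum>j\<in>Poly_Mapping.keys m'. cscale (of_nat (Poly_Mapping.lookup m' j)) (T j))"
    by (simp add: ext_deriv_def T_def)
  also have "\<dots> = (\<Sum>j\<in>?K. cscale (of_nat (Poly_Mapping.lookup m' j)) (T j))"
    by (intro sum.mono_neutral_left) (auto simp: in_keys_iff lk split: if_splits)
  also have "\<dots> = (\<Sum>j\<in>?K. if j = i then T j else 0) +
      (\<Sum>j\<in>?K. cscale (of_nat (Poly_Mapping.lookup m j)) (T j))"
    unfolding sum.distrib[symmetric]
    by (intro sum.cong refl) (simp add: lk cvs.scale_left_distrib)
  also have "(\<Sum>j\<in>?K. if j = i then T j else 0) = T i"
    by simp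
  also have "T i = tensor (basis_vec m) (wedge_basis i S)"
    by (simp add: T_def m'_def)
  also have "(\<Sum>j\<in>?K. cscale (of_nat (Poly_Mapping.lookup m j)) (T j)) =
      (\<Sum>j\<in>Poly_Mapping.keys m. cscale (of_nat (Poly_Mapping.lookup m j)) (T j))"
    by (intro sum.mono_neutral_right) (auto simp: in_keys_iff)
  also have "\<dots> = (\<Sum>j\<in>Poly_Mapping.keys m. cscale (of_nat (Poly_Mapping.lookup m j))
      (sym_mult (basis_vec (Poly_Mapping.single i 1))
        (tensor (basis_vec (m - Poly_Mapping.single j 1)) (wedge_basis j S))))"
  proof (intro sum.cong refl)
    fix j assume "j \<in> Poly_Mapping.keys m"
    then have "m' - Poly_Mapping.single j 1 = Poly_Mapping.single i 1 + (m - Poly_Mapping.single j 1)"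
      by (intro poly_mapping_eqI)
        (auto simp: m'_def lookup_add lookup_minus lookup_single when_def in_keys_iff)
    then show "cscale (of_nat (Poly_Mapping.lookup m j)) (T j) =
        cscale (of_nat (Poly_Mapping.lookup m j)) (sym_mult (basis_vec (Poly_Mapping.single i 1))
          (tensor (basis_vec (m - Poly_Mapping.single j 1)) (wedge_basis j S)))"
      by (simp add: T_def sym_mult_tensor basis_vec_mult)
  qed
  also have "\<dots> = sym_mult (basis_vec (Poly_Mapping.single i 1)) (ext_deriv (basis_vec (m, S)))"
    by (simp add: ext_deriv_def lin_sum[OF sym_mult_lin_right] lin_scale[OF sym_mult_lin_right])
  finally show ?thesis
    by (simp add: m'_def)
qed

lemma ext_deriv_leibniz:
  "ext_deriv (tensor (lin_form l * f) w) =
     tensor f (wedge_left l w) + sym_mult (lin_form l) (ext_deriv (tensor f w))"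
proof -
  have 1: "ext_deriv (tensor (lin_form (basis_vec i) * basis_vec m) (basis_vec S)) =
     tensor (basis_vec m) (wedge_left (basis_vec i) (basis_vec S)) +
     sym_mult (lin_form (basis_vec i)) (ext_deriv (tensor (basis_vec m) (basis_vec S)))" for i m S
    using ext_deriv_leibniz_basis[of i m S] by (simp add: lin_form_def basis_vec_mult)
  have 2: "ext_deriv (tensor (lin_form (basis_vec i) * f) (basis_vec S)) =
     tensor f (wedge_left (basis_vec i) (basis_vec S)) +
     sym_mult (lin_form (basis_vec i)) (ext_deriv (tensor f (basis_vec S)))" for i S
    by (rule lin_eq_on_basis[where v = f])
      (intro lin_plus lin_compose[OF ext_deriv_lin] lin_compose[OF tensor_lin_left]
        lin_compose[OF sym_mult_lin_right] tensor_lin_left mult_lin_right 1)+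
  have 3: "ext_deriv (tensor (lin_form (basis_vec i) * f) w) =
     tensor f (wedge_left (basis_vec i) w) +
     sym_mult (lin_form (basis_vec i)) (ext_deriv (tensor f w))" for i
    by (rule lin_eq_on_basis[where v = w])
      (intro lin_plus lin_compose[OF ext_deriv_lin] lin_compose[OF tensor_lin_right]
        lin_compose[OF sym_mult_lin_right] tensor_lin_right wedge_left_lin_right 2)+
  show ?thesis
    by (rule lin_eq_on_basis[where v = l])
      (intro lin_plus lin_compose[OF ext_deriv_lin] lin_compose[OF tensor_lin_left]
        lin_compose[OF tensor_lin_right] lin_compose[OF mult_lin_left] lin_form_lin
        lin_compose[OF sym_mult_lin_left] wedge_left_lin_left 3)+
qed

lemma ext_deriv_prod:
  fixes q :: nat
  shows "ext_deriv (tensor (\<Prod>s<q. lin_form (l s)) w) =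
     (\<Sum>s<q. tensor (\<Prod>t\<in>{..<q} - {s}. lin_form (l t)) (wedge_left (l s) w))"
proof (induction q)
  case 0
  have "ext_deriv (tensor (basis_vec 0) w) = 0"
    by (rule lin_eq_on_basis[where v = w],
        rule lin_compose[OF ext_deriv_lin tensor_lin_right], rule lin_const_zero,
        simp add: ext_deriv_def)
  then show ?case
    by (simp add: basis_vec_def)
next
  case (Suc q)
  have "(\<Prod>t\<in>{..<Suc q} - {s}. lin_form (l t)) =
      lin_form (l q) * (\<Prod>t\<in>{..<q} - {s}. lin_form (l t))" if "s < q" for s
  proof -
    have "{..<Suc q} - {s} = insert q ({..<q} - {s})"
      using that by auto
    then show ?thesis
      by simp
  qed
  moreover have "{..<Suc q} - {q} = {..<q}"
    by auto
  moreover have "(\<Prod>s<Suc q. lin_form (l s)) = lin_form (l q) * (\<Prod>s<q. lin_form (l s))"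
    by (simp add: mult.commute)
  ultimately show ?case
    by (simp del: prod.lessThan_Suc add: ext_deriv_leibniz Suc.IH lin_sum[OF sym_mult_lin_right] sym_mult_tensor add.commute)
qed

lemma ext_deriv_decomposable:
  fixes q :: nat
  shows "ext_deriv (tensor (\<Prod>s<q. lin_form (l s)) (wedge_list ms)) =
     (\<Sum>s<q. tensor (\<Prod>t\<in>{..<q} - {s}. lin_form (l t)) (wedge_list (l s # ms)))"
  by (simp add: ext_deriv_prod wedge_list_def)

definition mono_eval :: "('b \<Rightarrow>\<^sub>0 nat) \<Rightarrow> ('b \<Rightarrow>\<^sub>0 complex) \<Rightarrow> complex" where
  "mono_eval m z = (\<Prod>b\<in>Poly_Mapping.keys m. Poly_Mapping.lookup z b ^ Poly_Mapping.lookup m b)"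

lemma mono_eval_add: "mono_eval (m + m') z = mono_eval m z * mono_eval m' z"
proof -
  let ?A = "Poly_Mapping.keys m \<union> Poly_Mapping.keys m'"
  have sup: "mono_eval u z = (\<Prod>b\<in>?A. Poly_Mapping.lookup z b ^ Poly_Mapping.lookup u b)"
    if "Poly_Mapping.keys u \<subseteq> ?A" for u
    unfolding mono_eval_def using that by (intro prod.mono_neutral_left) (auto simp: in_keys_iff)
  show ?thesis
    using keys_add[of m m'] by (simp add: sup lookup_add power_add prod.distrib)
qed

lemma peval_alt: "peval F z = (\<Sum>m\<in>Poly_Mapping.keys F. Poly_Mapping.lookup F m * mono_eval m z)"
  by (simp add: peval_def mono_eval_def)

lemma peval_superset:
  assumes "finite A" "Poly_Mapping.keys F \<subseteq> A"
  shows "peval F z = (\<Sum>m\<in>A. Poly_Mapping.lookup F m * mono_eval m z)"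
  unfolding peval_alt using assms
  by (intro sum.mono_neutral_left) (auto simp: in_keys_iff)

lemma peval_add: "peval (F + G) z = peval F z + peval G z"
proof -
  let ?A = "Poly_Mapping.keys F \<union> Poly_Mapping.keys G"
  show ?thesis
    using keys_add[of F G]
    by (simp add: peval_superset[of ?A] lookup_add algebra_simps sum.distrib)
qed

lemma peval_single: "peval (Poly_Mapping.single m c) z = c * mono_eval m z"
  by (subst peval_superset[of "{m}"]) auto

lemma peval_zero: "peval 0 z = 0"
  by (simp add: peval_def)

lemma peval_sum: "peval (sum h I) z = (\<Sum>i\<in>I. peval (h i) z)"
  by (induction I rule: infinite_finite_induct) (auto simp: peval_add peval_zero)

lemma peval_mult: "peval (F * G) z = peval F z * peval G z"
proof -
  have expand: "H = (\<Sum>m\<in>Poly_Mapping.keys H. Poly_Mapping.single m (Poly_Mapping.lookup H m))"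
    for H :: "('a \<Rightarrow>\<^sub>0 nat) \<Rightarrow>\<^sub>0 complex"
    unfolding single_conv_basis_vec by (rule basis_expansion)
  have "peval (F * G) z = (\<Sum>m\<in>Poly_Mapping.keys F. \<Sum>m'\<in>Poly_Mapping.keys G.
      Poly_Mapping.lookup F m * Poly_Mapping.lookup G m' * mono_eval (m + m') z)"
    by (subst expand[of F], subst expand[of G])
      (simp add: sum_product peval_sum mult_single peval_single)
  also have "\<dots> = peval F z * peval G z"
    by (simp add: peval_alt sum_product mono_eval_add mult_ac)
  finally show ?thesis .
qed

lemma peval_hom: "comm_ring_hom (\<lambda>F. peval F z)"
proof
  show "peval 1 z = 1"
    using peval_single[of 0 1 z] by (simp add: mono_eval_def)
qed (simp_all add: peval_zero peval_add peval_mult)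

lemma finite_exps: "finite A \<Longrightarrow> finite (exps A d)"
proof -
  assume A: "finite A"
  have "Poly_Mapping.lookup ` exps A d \<subseteq>
      {f. \<forall>x. (x \<in> A \<longrightarrow> f x \<in> {..d}) \<and> (x \<notin> A \<longrightarrow> f x = 0)}"
  proof (safe, goal_cases)
    case (1 _ m x)
    show ?case
    proof (cases "x \<in> Poly_Mapping.keys m")
      case True
      then have "Poly_Mapping.lookup m x \<le> (\<Sum>a\<in>Poly_Mapping.keys m. Poly_Mapping.lookup m a)"
        by (intro member_le_sum) simp_all
      then show ?thesis
        using 1 by (simp add: exps_def)
    qed (simp add: in_keys_iff)
  qed (auto simp: exps_def in_keys_iff)
  then have "finite (Poly_Mapping.lookup ` exps A d)"
    using A by (rule finite_subset[OF _ finite_set_of_finite_funs]) auto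
  then show ?thesis
    by (rule finite_imageD) (rule inj_onI, simp only: poly_mapping.lookup_inject)
qed

lemma diff_monom_lin: "lin (diff_monom g)"
proof -
  have p: "lin (partial i)" for i
    unfolding partial_def by (rule lin_ext_lin)
  have pow: "lin (\<lambda>u. (partial i ^^ k) u)" for i k
  proof (induction k)
    case (Suc k)
    show ?case
      using lin_compose[OF p[of i] Suc.IH] by simp
  qed (simp add: lin_id)
  have "lin (\<lambda>u. foldr (\<lambda>i. partial i ^^ Poly_Mapping.lookup g i) is u)" for "is"
    by (induction "is") (simp_all add: lin_id lin_compose[OF pow])
  then show ?thesis
    unfolding diff_monom_def[abs_def] .
qed

lemma koszul_basis:
  "koszul Q (basis_vec b) = ext_deriv (tensor (diff_monom (fst b) Q) (basis_vec (snd b)))"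
  by (simp add: koszul_def tensor_map_def flattening_def case_prod_beta)

lemma koszul_entry_sum:
  assumes "Q \<in> Sym n d"
  shows "koszul_entry Q b c =
    (\<Sum>m\<in>exps {1..n} d. Poly_Mapping.lookup Q m * koszul_entry (basis_vec m) b c)"
proof -
  have l: "lin (\<lambda>Q. koszul Q (basis_vec c))"
    unfolding koszul_basis
    by (intro lin_compose[OF ext_deriv_lin] lin_compose[OF tensor_lin_left] diff_monom_lin)
  have "koszul Q (basis_vec c) = (\<Sum>m\<in>Poly_Mapping.keys Q.
      cscale (Poly_Mapping.lookup Q m) (koszul (basis_vec m) (basis_vec c)))"
    by (subst basis_expansion[of Q]) (simp add: lin_sum[OF l] lin_scale[OF l])
  then have "koszul_entry Q b c =
      (\<Sum>m\<in>Poly_Mapping.keys Q. Poly_Mapping.lookup Q m * koszul_entry (basis_vec m) b c)"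
    by (simp add: koszul_entry_def lookup_sum)
  also have "\<dots> = (\<Sum>m\<in>exps {1..n} d. Poly_Mapping.lookup Q m * koszul_entry (basis_vec m) b c)"
    using assms by (intro sum.mono_neutral_left finite_exps)
      (auto simp: Sym_def free_vs_def in_keys_iff)
  finally show ?thesis .
qed

lemma peval_koszul_entry_poly:
  assumes "Q \<in> Sym n d"
  shows "peval (koszul_entry_poly n d b c) Q = koszul_entry Q b c"
  unfolding koszul_entry_sum[OF assms] koszul_entry_poly_def peval_sum peval_single
  by (simp add: mono_eval_def mult.commute)

lemma peval_koszul_minor:
  assumes "Q \<in> Sym n d" "length bs = length cs"
  shows "peval (koszul_minor n d bs cs) Q =
    det (mat (length bs) (length cs) (\<lambda>(i, j). koszul_entry Q (bs ! i) (cs ! j)))"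
proof -
  interpret comm_ring_hom "\<lambda>F. peval F Q"
    by (rule peval_hom)
  have "peval (koszul_minor n d bs cs) Q =
      det (map_mat (\<lambda>F. peval F Q) (mat (length bs) (length cs)
        (\<lambda>(i, j). koszul_entry_poly n d (bs ! i) (cs ! j))))"
    unfolding koszul_minor_def by (rule hom_det[symmetric])
  also have "map_mat (\<lambda>F. peval F Q) (mat (length bs) (length cs)
        (\<lambda>(i, j). koszul_entry_poly n d (bs ! i) (cs ! j))) =
      mat (length bs) (length cs) (\<lambda>(i, j). koszul_entry Q (bs ! i) (cs ! j))"
    using assms by (intro eq_matI) (auto simp: peval_koszul_entry_poly)
  finally show ?thesis .
qed

end

theory Submission
  imports Defs
begin

text \<open>
  A monomial operator of degree \<open>k\<close> sends a block \<open>x\<^sub>1 \<cdots> x\<^sub>d\<close> to \<open>0\<close> or to a product \<open>x\<^sup>U\<close> of \<open>d - k\<close>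
  of its variables, so the image is spanned by the \<open>ext_deriv (x\<^sup>U \<otimes> x\<^sub>S)\<close>.  When \<open>S\<close> lies in the same
  block, \<open>ext_deriv \<circ> ext_deriv = 0\<close> lets one restrict to those \<open>(U, S)\<close> for which the least element of
  the symmetric difference lies in \<open>U\<close>; counting these pairs by \<open>card (U \<inter> S)\<close> gives \<open>S_num\<close>.

  For \<open>k = p = 1\<close> no degeneration argument is needed to pass to the secant variety: if
  \<open>f = l\<^sub>1 \<cdots> l\<^sub>d\<close> with arbitrary nonzero linear forms \<open>l\<^sub>i\<close>, the image of \<open>koszul f\<close> lies in the span of
  the \<open>d n\<close> vectors \<open>ext_deriv (f/l\<^sub>i \<otimes> x\<^sub>a)\<close>, and \<open>ext_deriv (ext_deriv f) = 0\<close> is the relation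
  \<open>\<Sum>\<^sub>i ext_deriv (f/l\<^sub>i \<otimes> l\<^sub>i) = 0\<close>, so one of the vectors is redundant.  Hence a combination of \<open>r\<close>
  such products has rank at most \<open>r (d n - 1)\<close>.
\<close>

section \<open>Linear maps, spans and ranks\<close>

lemma cscale_lin: "lin (cscale c)"
  by (auto intro!: linI simp: cvs.scale_right_distrib mult.commute)

lemma lin_sum_fun: "(\<And>i. i \<in> I \<Longrightarrow> lin (h i)) \<Longrightarrow> lin (\<lambda>v. \<Sum>i\<in>I. h i v)"
  by (auto intro!: linI simp: lin_add lin_scale sum.distrib cvs.scale_sum_right)

lemma lin_image_in_span:
  assumes "lin F" "v \<in> free_vs B" "\<And>b. b \<in> B \<Longrightarrow> F (basis_vec b) \<in> cvs.span W"
  shows "F v \<in> cvs.span W"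
proof -
  have "F v = (\<Sum>b\<in>Poly_Mapping.keys v. cscale (Poly_Mapping.lookup v b) (F (basis_vec b)))"
    by (subst basis_expansion[of v]) (simp add: lin_sum[OF assms(1)] lin_scale[OF assms(1)])
  also have "\<dots> \<in> cvs.span W"
    using assms by (intro cvs.span_sum cvs.span_scale) (auto simp: free_vs_def)
  finally show ?thesis .
qed

lemma koszul_lin: "lin (koszul Q)"
  unfolding koszul_def comp_def tensor_map_def
  by (intro lin_compose[OF ext_deriv_lin] lin_ext_lin)

text \<open>Linearity in the polynomial, with the argument fixed: it allows a sum of products to be
  treated one product at a time.\<close>

lemma koszul_basis_lin: "lin (\<lambda>Q. koszul Q (basis_vec b))"
  unfolding koszul_basis
  by (intro lin_compose[OF ext_deriv_lin] lin_compose[OF tensor_lin_left] diff_monom_lin)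

text \<open>Rank bounds below come from a finite spanning set of the image, tested on basis vectors;
  only its cardinality has to be estimated.\<close>

lemma koszul_rank_le:
  assumes "finite W" "\<And>b. b \<in> sym_ext_basis n k p \<Longrightarrow> koszul Q (basis_vec b) \<in> cvs.span W"
  shows "koszul_rank n k p Q \<le> card W"
  unfolding koszul_rank_def lin_rank_def
proof (rule cvs.dim_le_card)
  show "koszul Q ` SymExt n k p \<subseteq> cvs.span W"
    using lin_image_in_span[OF koszul_lin _ assms(2)] by (auto simp: SymExt_def)
qed (rule assms)

lemma eq_uminus_self_zero:
  assumes "u = - (u :: 'b \<Rightarrow>\<^sub>0 complex)"
  shows "u = 0"
proof (rule poly_mapping_eqI)
  fix k
  have "Poly_Mapping.lookup u k = - Poly_Mapping.lookup u k"
    using assms by (metis lookup_uminus)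
  then show "Poly_Mapping.lookup u k = Poly_Mapping.lookup 0 k"
    by simp
qed

section \<open>The exterior derivative squares to zero\<close>

text \<open>Summands outside the support of \<open>m\<close> have coefficient 0. A common index set
  \<open>A\<close> lets the two sums in \<open>ext_deriv (ext_deriv _)\<close> run over the same
  range, so that they can be swapped.\<close>

lemma ext_deriv_tensor_basis:
  assumes "finite A" "Poly_Mapping.keys m \<subseteq> A"
  shows "ext_deriv (tensor (basis_vec m) w) =
    (\<Sum>i\<in>A. cscale (of_nat (Poly_Mapping.lookup m i))
      (tensor (basis_vec (m - Poly_Mapping.single i 1)) (wedge_left (basis_vec i) w)))"
proof (rule lin_eq_on_basis[where v = w])
  fix S
  show "ext_deriv (tensor (basis_vec m) (basis_vec S)) =
    (\<Sum>i\<in>A. cscale (of_nat (Poly_Mapping.lookup m i))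
      (tensor (basis_vec (m - Poly_Mapping.single i 1)) (wedge_left (basis_vec i) (basis_vec S))))"
    using assms by (simp add: ext_deriv_def, intro sum.mono_neutral_left) (auto simp: in_keys_iff)
qed (intro lin_sum_fun lin_compose[OF cscale_lin] lin_compose[OF tensor_lin_right]
      lin_compose[OF ext_deriv_lin] wedge_left_lin_right tensor_lin_right)+

text \<open>Second derivatives are symmetric in \<open>i\<close> and \<open>j\<close>, the wedge of
  two vectors is antisymmetric; the double sum therefore equals its own negative.\<close>

lemma ext_deriv_ext_deriv_basis:
  assumes "finite S"
  shows "ext_deriv (ext_deriv (basis_vec (m, S))) = 0"
proof -
  let ?K = "Poly_Mapping.keys m" and ?e = "\<lambda>i. Poly_Mapping.single i (1 :: nat)"
  define T where "T i j = cscale (of_nat (Poly_Mapping.lookup m i * Poly_Mapping.lookup (m - ?e i) j))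
      (tensor (basis_vec (m - ?e i - ?e j)) (wedge_left (basis_vec j) (wedge_basis i S)))" for i j
  have T: "T i j = - T j i" for i j
  proof -
    have "m - ?e i - ?e j = m - ?e j - ?e i"
      by (simp add: diff_diff_add add.commute)
    moreover have "Poly_Mapping.lookup m i * Poly_Mapping.lookup (m - ?e i) j =
        Poly_Mapping.lookup m j * Poly_Mapping.lookup (m - ?e j) i"
      by (auto simp: lookup_minus lookup_single when_def)
    ultimately show ?thesis
      unfolding T_def wedge_left_anticommute_basis[OF assms, of j i]
      by (simp add: module_hom.neg[OF tensor_lin_right[unfolded Vector_Spaces.linear_iff_module_hom]])
  qed
  have sub: "Poly_Mapping.keys (m - ?e i) \<subseteq> ?K" for i
    by (auto simp: in_keys_iff lookup_minus)
  have "ext_deriv (ext_deriv (basis_vec (m, S))) = (\<Sum>i\<in>?K. \<Sum>j\<in>?K. T i j)" (is "?X = ?Y")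
    using ext_deriv_tensor_basis[of ?K m "basis_vec S"]
    by (simp add: lin_sum[OF ext_deriv_lin] lin_scale[OF ext_deriv_lin]
        ext_deriv_tensor_basis[OF _ sub] cvs.scale_sum_right T_def del: One_nat_def)
  also have "?Y = - ?Y"
    by (subst (1) sum.swap, subst T) (simp add: sum_negf)
  then have "?Y = 0"
    by (rule eq_uminus_self_zero)
  finally show ?thesis .
qed

lemma ext_deriv_ext_deriv_tensor:
  assumes "finite S"
  shows "ext_deriv (ext_deriv (tensor f (basis_vec S))) = 0"
  by (rule lin_eq_on_basis[where v = f])
    (simp_all add: lin_compose[OF ext_deriv_lin lin_compose[OF ext_deriv_lin tensor_lin_left]]
      lin_const_zero ext_deriv_ext_deriv_basis assms)

section \<open>Squarefree monomials\<close>

definition sqfree_exp :: "nat set \<Rightarrow> (nat \<Rightarrow>\<^sub>0 nat)" where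
  "sqfree_exp U = (\<Sum>i\<in>U. Poly_Mapping.single i 1)"

lemma lookup_sqfree_exp:
  "finite U \<Longrightarrow> Poly_Mapping.lookup (sqfree_exp U) i = (if i \<in> U then 1 else 0)"
  by (simp add: sqfree_exp_def lookup_sum lookup_single when_def)

lemma keys_sqfree_exp: "finite U \<Longrightarrow> Poly_Mapping.keys (sqfree_exp U) = U"
  by (auto simp: in_keys_iff lookup_sqfree_exp split: if_splits)

lemma sqfree_exp_minus_single:
  "finite U \<Longrightarrow> sqfree_exp U - Poly_Mapping.single i 1 = sqfree_exp (U - {i})"
  by (rule poly_mapping_eqI) (auto simp: lookup_sqfree_exp lookup_minus lookup_single when_def)

lemma prod_sym_var: "finite U \<Longrightarrow> (\<Prod>i\<in>U. sym_var i) = basis_vec (sqfree_exp U)"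
proof (induction U rule: finite_induct)
  case empty
  then show ?case
    by (simp add: basis_vec_def sqfree_exp_def)
next
  case (insert i U)
  then show ?case
    by (simp add: sym_var_def lin_form_def basis_vec_mult sqfree_exp_def)
qed

section \<open>Derivatives of monomials\<close>

lemma partial_lin: "lin (partial i)"
  unfolding partial_def by (rule lin_ext_lin)

lemma partial_basis:
  "partial i (basis_vec m) =
    cscale (of_nat (Poly_Mapping.lookup m i)) (basis_vec (m - Poly_Mapping.single i 1))"
  by (simp add: partial_def single_conv_basis_vec[of _ "of_nat _"])

lemma partial_pow_lin: "lin (partial i ^^ k)"
proof (induction k)
  case (Suc k)
  show ?case
    using lin_compose[OF partial_lin[of i] Suc] by (simp add: comp_def)
qed (simp add: lin_id id_def)

text \<open>The scalar is a falling factorial whose value does not matter. The second conjunct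
  records that subtraction of exponents is not truncated whenever the scalar is nonzero.\<close>

lemma partial_pow_basis:
  "\<exists>c. (partial i ^^ k) (basis_vec m) = cscale c (basis_vec (m - Poly_Mapping.single i k)) \<and>
     (c \<noteq> 0 \<longrightarrow> k \<le> Poly_Mapping.lookup m i)"
proof (induction k)
  case 0
  show ?case
    by (intro exI[of _ 1]) simp
next
  case (Suc k)
  then obtain c where c: "(partial i ^^ k) (basis_vec m) = cscale c (basis_vec (m - Poly_Mapping.single i k))"
    "c \<noteq> 0 \<Longrightarrow> k \<le> Poly_Mapping.lookup m i"
    by blast
  have "m - Poly_Mapping.single i k - Poly_Mapping.single i 1 = m - Poly_Mapping.single i (Suc k)"
    by (simp add: diff_diff_add flip: single_add)
  then have "(partial i ^^ Suc k) (basis_vec m) =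
      cscale (c * of_nat (Poly_Mapping.lookup m i - k)) (basis_vec (m - Poly_Mapping.single i (Suc k)))"
    by (simp add: c(1) lin_scale[OF partial_lin] partial_basis lookup_minus)
  \<comment> \<open>The new factor is nonzero exactly when \<open>Suc k\<close> is at most the
    exponent, since natural subtraction gives 0 otherwise.\<close>
  then show ?case
    by (intro exI[of _ "c * of_nat (Poly_Mapping.lookup m i - k)"]) auto
qed

lemma foldr_partial_basis:
  assumes "distinct is"
  shows "\<exists>c. foldr (\<lambda>i. partial i ^^ Poly_Mapping.lookup g i) is (basis_vec m) =
      cscale c (basis_vec (m - (\<Sum>i\<in>set is. Poly_Mapping.single i (Poly_Mapping.lookup g i)))) \<and>
     (c \<noteq> 0 \<longrightarrow> (\<forall>i\<in>set is. Poly_Mapping.lookup g i \<le> Poly_Mapping.lookup m i))"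
  using assms
proof (induction "is")
  case Nil
  show ?case
    by (intro exI[of _ 1]) simp
next
  case (Cons i "is")
  let ?h = "\<Sum>i\<in>set is. Poly_Mapping.single i (Poly_Mapping.lookup g i)"
  obtain c where c: "foldr (\<lambda>i. partial i ^^ Poly_Mapping.lookup g i) is (basis_vec m) =
      cscale c (basis_vec (m - ?h))"
     "c \<noteq> 0 \<Longrightarrow> \<forall>i\<in>set is. Poly_Mapping.lookup g i \<le> Poly_Mapping.lookup m i"
    using Cons by auto
  obtain c' where c': "(partial i ^^ Poly_Mapping.lookup g i) (basis_vec (m - ?h)) =
      cscale c' (basis_vec (m - ?h - Poly_Mapping.single i (Poly_Mapping.lookup g i)))"
     "c' \<noteq> 0 \<Longrightarrow> Poly_Mapping.lookup g i \<le> Poly_Mapping.lookup (m - ?h) i"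
    using partial_pow_basis by blast
  have "foldr (\<lambda>i. partial i ^^ Poly_Mapping.lookup g i) (i # is) (basis_vec m) =
      cscale (c * c') (basis_vec (m - (\<Sum>i\<in>set (i # is). Poly_Mapping.single i (Poly_Mapping.lookup g i))))"
    using Cons.prems by (simp add: c(1) c'(1) lin_scale[OF partial_pow_lin] diff_diff_add add.commute)
  moreover have "Poly_Mapping.lookup g i \<le> Poly_Mapping.lookup m i" if "c' \<noteq> 0"
    using c'(2)[OF that] by (simp add: lookup_minus)
  ultimately show ?case
    using c(2) by (intro exI[of _ "c * c'"]) auto
qed

lemma diff_monom_basis:
  "\<exists>c. diff_monom g (basis_vec m) = cscale c (basis_vec (m - g)) \<and>
    (c \<noteq> 0 \<longrightarrow> (\<forall>i. Poly_Mapping.lookup g i \<le> Poly_Mapping.lookup m i))"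
proof -
  have "(\<Sum>i\<in>Poly_Mapping.keys g. Poly_Mapping.single i (Poly_Mapping.lookup g i)) = g"
    by (rule poly_mapping_eqI)
      (simp add: lookup_sum lookup_single when_def in_keys_iff)
  moreover have "(\<forall>i\<in>Poly_Mapping.keys g. Poly_Mapping.lookup g i \<le> Poly_Mapping.lookup m i)
      \<longleftrightarrow> (\<forall>i. Poly_Mapping.lookup g i \<le> Poly_Mapping.lookup m i)"
    by (metis in_keys_iff zero_le)
  ultimately show ?thesis
    using foldr_partial_basis[of "sorted_list_of_set (Poly_Mapping.keys g)" g m]
    unfolding diff_monom_def by (simp del: cvs.scale_cancel_right)
qed


text \<open>A nonzero coefficient forces \<open>g\<close> to be at most the indicator of
  \<open>B\<close>, so \<open>g\<close> is itself squarefree with support \<open>T\<close> of size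
  \<open>k\<close>, and the derivative is a multiple of the monomial on
  \<open>B - T\<close>.\<close>

lemma koszul_sqfree_in_span:
  assumes "finite B" "card B = d" "g \<in> exps {1..n} k"
  shows "koszul (basis_vec (sqfree_exp B)) (basis_vec (g, S)) \<in>
    cvs.span ((\<lambda>U. ext_deriv (basis_vec (sqfree_exp U, S))) ` {U. U \<subseteq> B \<and> card U = d - k})"
    (is "_ \<in> cvs.span ?W")
proof -
  obtain c where c: "diff_monom g (basis_vec (sqfree_exp B)) = cscale c (basis_vec (sqfree_exp B - g))"
    "c \<noteq> 0 \<Longrightarrow> Poly_Mapping.lookup g i \<le> Poly_Mapping.lookup (sqfree_exp B) i" for i
    using diff_monom_basis[of g "sqfree_exp B"] by blast
  have k: "koszul (basis_vec (sqfree_exp B)) (basis_vec (g, S)) =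
      cscale c (ext_deriv (basis_vec (sqfree_exp B - g, S)))"
    by (simp add: koszul_basis c(1) lin_scale[OF ext_deriv_lin] lin_scale[OF tensor_lin_left])
  show ?thesis
  proof (cases "c = 0")
    case True
    then show ?thesis
      by (simp add: k cvs.span_zero)
  next
    case False
    define T where "T = Poly_Mapping.keys g"
    have le: "Poly_Mapping.lookup g i \<le> (if i \<in> B then 1 else 0)" for i
      using c(2)[OF False, of i] assms(1) by (simp add: lookup_sqfree_exp)
    have T: "T \<subseteq> B"
      using le by (fastforce simp: T_def in_keys_iff split: if_splits)
    have g: "Poly_Mapping.lookup g i = (if i \<in> T then 1 else 0)" for i
      using le[of i] by (auto simp: T_def in_keys_iff split: if_splits)
    have "card T = k"
      using assms(3) by (simp add: exps_def g flip: T_def)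
    moreover have "sqfree_exp B - g = sqfree_exp (B - T)"
      using assms(1) T by (intro poly_mapping_eqI) (auto simp: lookup_minus lookup_sqfree_exp g)
    ultimately have "ext_deriv (basis_vec (sqfree_exp B - g, S)) \<in> ?W"
      using assms T by (auto simp: card_Diff_subset finite_subset)
    then show ?thesis
      unfolding k by (intro cvs.span_scale cvs.span_base)
  qed
qed

section \<open>A spanning set for the image of a single block\<close>

lemma ext_deriv_sqfree:
  assumes "finite U"
  shows "ext_deriv (basis_vec (sqfree_exp U, S)) =
    (\<Sum>i\<in>U. tensor (basis_vec (sqfree_exp (U - {i}))) (wedge_basis i S))"
  using ext_deriv_tensor_basis[of U "sqfree_exp U" "basis_vec S"] assms
  by (simp add: keys_sqfree_exp lookup_sqfree_exp sqfree_exp_minus_single del: One_nat_def)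

lemma ext_deriv_tensor_wedge_basis:
  "ext_deriv (tensor (basis_vec m) (wedge_basis i G)) =
    (if i \<in> G then 0
     else cscale ((-1) ^ card {j \<in> G. j < i}) (ext_deriv (basis_vec (m, insert i G))))"
  by (simp add: wedge_basis_def single_conv_basis_vec[of _ "_ ^ _"] lin_zero[OF tensor_lin_right]
      lin_zero[OF ext_deriv_lin] lin_scale[OF tensor_lin_right] lin_scale[OF ext_deriv_lin])

text \<open>This is the identity \<open>ext_deriv \<circ> ext_deriv = 0\<close> at \<open>x\<^sub>e x\<^sup>U \<otimes> x\<^sub>G\<close>.\<close>

lemma ext_deriv_exchange:
  assumes "finite U" "finite G" "e \<notin> U" "e \<notin> G"
  shows "ext_deriv (basis_vec (sqfree_exp U, insert e G)) \<in>
    cvs.span ((\<lambda>i. ext_deriv (basis_vec (sqfree_exp (insert e U - {i}), insert i G))) ` (U - G))"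
    (is "?x \<in> cvs.span ?W")
proof -
  let ?t = "\<lambda>i. ext_deriv (tensor (basis_vec (sqfree_exp (insert e U - {i}))) (wedge_basis i G))"
  have "0 = ext_deriv (ext_deriv (basis_vec (sqfree_exp (insert e U), G)))"
    using assms(2) by (simp add: ext_deriv_ext_deriv_basis)
  also have "\<dots> = (\<Sum>i\<in>insert e U. ?t i)"
    using assms by (simp add: ext_deriv_sqfree lin_sum[OF ext_deriv_lin] lin_add[OF ext_deriv_lin])
  also have "\<dots> = ?t e + (\<Sum>i\<in>U. ?t i)"
    using assms by simp
  finally have "?t e = - (\<Sum>i\<in>U. ?t i)"
    by (simp add: eq_neg_iff_add_eq_0)
  moreover have "insert e U - {e} = U"
    using assms by auto
  ultimately have "cscale ((-1) ^ card {j \<in> G. j < e}) ?x = - (\<Sum>i\<in>U. ?t i)"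
    using assms(4) by (simp add: ext_deriv_tensor_wedge_basis[of "sqfree_exp U"])
  \<comment> \<open>Summands with \<open>i \<in> G\<close> vanish because the wedge repeats a
    factor; only \<open>U - G\<close> remains.\<close>
  also have "\<dots> \<in> cvs.span ?W"
    unfolding ext_deriv_tensor_wedge_basis
    by (intro cvs.span_neg cvs.span_sum)
      (simp add: cvs.span_zero, intro impI cvs.span_scale cvs.span_base imageI, simp)
  \<comment> \<open>The sign is its own inverse, so multiplying by it again isolates
    \<open>?x\<close>.\<close>
  finally have "cscale ((-1) ^ card {j \<in> G. j < e}) (cscale ((-1) ^ card {j \<in> G. j < e}) ?x) \<in> cvs.span ?W"
    by (rule cvs.span_scale)
  then show ?thesis
    by (simp flip: power_mult_distrib)
qed

text \<open>Stating minimality through a witness \<open>e\<close> instead of \<open>Min\<close> also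
  excludes \<open>U = S\<close>, where the symmetric difference is empty.\<close>

definition block_pairs :: "nat set \<Rightarrow> nat \<Rightarrow> nat \<Rightarrow> (nat set \<times> nat set) set" where
  "block_pairs B a p = {(U, S). U \<subseteq> B \<and> card U = a \<and> S \<subseteq> B \<and> card S = p \<and>
     (\<exists>e\<in>U - S. \<forall>x\<in>(U - S) \<union> (S - U). e \<le> x)}"

text \<open>If the least element \<open>e\<close> of the symmetric difference lies in
  \<open>S\<close>, the exchange relation moves \<open>e\<close> to the symmetric factor and some
  \<open>i \<in> U - S\<close> to the wedge. The symmetric difference stays the same set, so
  \<open>e\<close> is still least, now on the right side: one exchange suffices. For
  \<open>U = S\<close> every wedge repeats a factor.\<close>

lemma ext_deriv_in_span_block_pairs:
  assumes "finite B" "U \<subseteq> B" "S \<subseteq> B"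
  shows "ext_deriv (basis_vec (sqfree_exp U, S)) \<in>
    cvs.span ((\<lambda>(U, S). ext_deriv (basis_vec (sqfree_exp U, S))) ` block_pairs B (card U) (card S))"
    (is "?E U S \<in> cvs.span ?W")
proof -
  let ?D = "\<lambda>U S. (U - S) \<union> (S - U)"
  have fin: "finite U" "finite S"
    using assms finite_subset by auto
  consider "U = S" | "U \<noteq> S" "Min (?D U S) \<in> U - S" | "U \<noteq> S" "Min (?D U S) \<in> S - U"
    using fin Min_in[of "?D U S"] by blast
  then show ?thesis
  proof cases
    case 1
    then have "?E U S = 0"
      using fin by (simp add: ext_deriv_sqfree wedge_basis_def lin_zero[OF tensor_lin_right])
    then show ?thesis
      by (simp add: cvs.span_zero)
  next
    case 2
    then have "(U, S) \<in> block_pairs B (card U) (card S)"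
      using assms fin by (auto simp: block_pairs_def intro!: bexI[of _ "Min (?D U S)"])
    then show ?thesis
      by (intro cvs.span_base) auto
  next
    case 3
    define e where "e = Min (?D U S)"
    have e: "e \<in> S" "e \<notin> U" "\<And>x. x \<in> ?D U S \<Longrightarrow> e \<le> x"
      using 3 fin by (auto simp: e_def)
    have "?E (insert e U - {i}) (insert i (S - {e})) \<in> ?W" if i: "i \<in> U - (S - {e})" for i
    proof -
      have i': "i \<in> U" "i \<notin> S" "i \<noteq> e"
        using i e by auto
      have "?D (insert e U - {i}) (insert i (S - {e})) = ?D U S"
        using i' e by auto
      moreover have "card (insert e U - {i}) = card U" "card (insert i (S - {e})) = card S"
        using fin e i' by (simp_all add: card_insert_if card_Diff_singleton_if)
          (metis Suc_pred card_gt_0_iff empty_iff)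
      ultimately have "(insert e U - {i}, insert i (S - {e})) \<in> block_pairs B (card U) (card S)"
        using assms i' e by (auto simp: block_pairs_def intro!: bexI[of _ e])
      then show ?thesis
        by (intro image_eqI) auto
    qed
    then have "cvs.span ((\<lambda>i. ?E (insert e U - {i}) (insert i (S - {e}))) ` (U - (S - {e})))
        \<subseteq> cvs.span ?W"
      by (intro cvs.span_mono) blast
    moreover have "insert e (S - {e}) = S"
      using e by auto
    ultimately show ?thesis
      using ext_deriv_exchange[of U "S - {e}" e] e fin by auto
  qed
qed

section \<open>Counting the pairs within one block\<close>

lemma card_Sigma_const:
  assumes "finite A" "\<And>x. x \<in> A \<Longrightarrow> finite (C x)" "\<And>x. x \<in> A \<Longrightarrow> card (C x) = c"
  shows "finite (Sigma A C)" "card (Sigma A C) = card A * c"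
  using assms by (auto simp: card_SigmaI)

text \<open>
  A pair \<open>(U, S)\<close> is encoded as \<open>(U \<inter> S, U \<triangle> S, S - U)\<close>, with \<open>\<triangle>\<close> the symmetric difference;
  the index \<open>s\<close> of \<open>S_num\<close> is \<open>card (U \<inter> S)\<close>.
\<close>

lemma card_block_pairs_le:
  assumes "finite B" "card B = d" "1 \<le> k" "k < d"
  shows "card (block_pairs B (d - k) p) \<le> S_num p d k"
proof -
  let ?I = "{p - k..min p (d - k - 1)}"
  \<comment> \<open>\<open>F\<close> stands for \<open>S - U\<close>. It avoids the least element of
    \<open>E\<close>, which lies in \<open>U\<close>; hence the \<open>- 1\<close> in the third
    binomial coefficient.\<close>
  define C where "C s E = {F. F \<subseteq> E - {Min E} \<and> card F = p - s}" for s and E :: "nat set"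
  define C' where "C' s D = Sigma {E. E \<subseteq> B - D \<and> card E = d - k + p - 2 * s} (C s)" for s D
  define T where "T s = Sigma {D. D \<subseteq> B \<and> card D = s} (C' s)" for s
  have T: "finite (T s)" "card (T s) = (d choose s) *
      (((d - s) choose (d - k + p - 2 * s)) * ((d - k + p - 2 * s - 1) choose (p - s)))"
    if s: "s \<in> ?I" for s
  proof -
    \<comment> \<open>The upper summation limit gives s \<le> p and s < d - k. Thus \<open>E\<close>
      is nonempty and \<open>Min E\<close> is a genuine element.\<close>
    have pos: "d - k + p - 2 * s > 0"
      using s assms by auto
    have C: "finite (C s E) \<and> card (C s E) = (d - k + p - 2 * s - 1) choose (p - s)"
      if "card E = d - k + p - 2 * s" for E
    proof -
      have "finite E" "E \<noteq> {}"
        using that pos by (auto intro: card_ge_0_finite)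
      then show ?thesis
        using that by (simp add: C_def n_subsets)
    qed
    have C': "finite (C' s D) \<and> card (C' s D) =
        ((d - s) choose (d - k + p - 2 * s)) * ((d - k + p - 2 * s - 1) choose (p - s))"
      if "D \<subseteq> B" "card D = s" for D
    proof -
      have "finite D"
        using that assms finite_subset by auto
      then have "card (B - D) = d - s"
        using that assms by (simp add: card_Diff_subset)
      then show ?thesis
        using assms C card_Sigma_const[of "{E. E \<subseteq> B - D \<and> card E = d - k + p - 2 * s}" "C s"]
        by (simp add: C'_def n_subsets)
    qed
    show "finite (T s)" "card (T s) = (d choose s) *
      (((d - s) choose (d - k + p - 2 * s)) * ((d - k + p - 2 * s - 1) choose (p - s)))"
      using assms C' card_Sigma_const[of "{D. D \<subseteq> B \<and> card D = s}" "C' s"]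
      by (simp_all add: T_def n_subsets)
  qed
  have "block_pairs B (d - k) p \<subseteq> (\<lambda>(D, E, F). (D \<union> (E - F), D \<union> F)) ` (\<Union>s\<in>?I. T s)"
  proof safe
    fix U S assume "(U, S) \<in> block_pairs B (d - k) p"
    then obtain e where US: "U \<subseteq> B" "card U = d - k" "S \<subseteq> B" "card S = p"
      and e: "e \<in> U" "e \<notin> S" "\<And>x. x \<in> (U - S) \<union> (S - U) \<Longrightarrow> e \<le> x"
      by (auto simp: block_pairs_def)
    define D E F where "D = U \<inter> S" and "E = (U - S) \<union> (S - U)" and "F = S - U"
    have fin: "finite U" "finite S"
      using US assms finite_subset by auto
    have min: "Min E = e"
      using e fin by (intro Min_eqI) (auto simp: E_def)
    have cF: "card D + card F = p"
      using card_Int_Diff[of S U] US fin by (simp add: D_def F_def Int_commute)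
    have cE: "card D + card (E - F) = d - k"
    proof -
      have "E - F = U - S"
        by (auto simp: E_def F_def)
      then show ?thesis
        using card_Int_Diff[of U S] US fin by (simp add: D_def)
    qed
    have "card E = card (E - F) + card F"
      using fin by (subst card_Diff_subset) (auto simp: E_def F_def card_mono intro!: le_add_diff_inverse2[symmetric])
    \<comment> \<open>The witness \<open>e\<close> lies in \<open>E - F\<close>; with
      \<open>cE\<close> this yields the upper limit d - k - 1 for s.\<close>
    moreover have "card (E - F) > 0"
      using e fin by (auto simp: card_gt_0_iff E_def F_def)
    \<comment> \<open>Here card D + card E is d - k + p - s, so this yields the lower limit p - k
      for s.\<close>
    moreover have "card D + card E \<le> d"
    proof -
      have "card D + card E = card (D \<union> E)"
        using fin by (intro card_Un_disjoint[symmetric]) (auto simp: D_def E_def)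
      also have "\<dots> \<le> card B"
        using US assms by (intro card_mono) (auto simp: D_def E_def)
      finally show ?thesis
        using assms by simp
    qed
    ultimately have s: "card D \<in> ?I" and E: "card E = d - k + p - 2 * card D" and F: "card F = p - card D"
      using cF cE assms by auto
    have "(D, E, F) \<in> T (card D)"
      using US e min E F by (auto simp: T_def C'_def C_def D_def E_def F_def)
    moreover have "U = D \<union> (E - F)" "S = D \<union> F"
      by (auto simp: D_def E_def F_def)
    ultimately show "(U, S) \<in> (\<lambda>(D, E, F). (D \<union> (E - F), D \<union> F)) ` (\<Union>s\<in>?I. T s)"
      using s by (intro image_eqI[where x = "(D, E, F)"]) auto
  qed
  then have "card (block_pairs B (d - k) p) \<le> card (\<Union>s\<in>?I. T s)"
    using T(1) by (intro surj_card_le) auto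
  also have "\<dots> \<le> (\<Sum>s\<in>?I. card (T s))"
    by (rule card_UN_le) simp
  also have "\<dots> = S_num p d k"
    using T(2) by (simp add: S_num_def mult.assoc)
  finally show ?thesis .
qed

section \<open>The rank bound for a sum of products in disjoint variables\<close>

lemma sum_of_products_eq:
  "sum_of_products r d = (\<Sum>j<r. basis_vec (sqfree_exp {j * d + 1..j * d + d}))"
proof -
  have "(\<Prod>i = 1..d. sym_var (j * d + i)) = (\<Prod>i\<in>{j * d + 1..j * d + d}. sym_var i)" for j
    by (rule prod.reindex_bij_witness[of _ "\<lambda>i. i - j * d" "\<lambda>i. j * d + i"]) auto
  then show ?thesis
    by (simp add: sum_of_products_def prod_sym_var)
qed

text \<open>Each block contributes its own spanning vectors: all pairs (\<open>U\<close>,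
  \<open>S\<close>) in \<open>A j\<close> when \<open>S\<close> leaves the block, which gives the
  binomial term, and only the reduced pairs when \<open>S\<close> stays inside, which gives
  \<open>S_num\<close>.\<close>

lemma koszul_rank_sum_of_products:
  assumes "1 \<le> k" "k < d"
  shows "koszul_rank (r * d) k p (sum_of_products r d)
    \<le> r * ((d choose k) * (((d * r) choose p) - (d choose p)) + S_num p d k)"
proof -
  let ?E = "\<lambda>(U, S). ext_deriv (basis_vec (sqfree_exp U, S))"
  define B where "B j = {j * d + 1..j * d + d}" for j
  define A where "A j = {U. U \<subseteq> B j \<and> card U = d - k} \<times>
      ({S. S \<subseteq> {1..r * d} \<and> card S = p} - {S. S \<subseteq> B j \<and> card S = p})" for j
  define W where "W = (\<Union>j<r. ?E ` (A j \<union> block_pairs (B j) (d - k) p))"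
  have B: "finite (B j)" "card (B j) = d" for j
    by (simp_all add: B_def)
  have Bsub: "B j \<subseteq> {1..r * d}" if "j < r" for j
  proof -
    have "(j + 1) * d \<le> r * d"
      using that by (intro mult_right_mono) auto
    then show ?thesis
      by (auto simp: B_def)
  qed
  have "block_pairs (B j) (d - k) p \<subseteq> Pow (B j) \<times> Pow (B j)" for j
    by (auto simp: block_pairs_def)
  then have fin_bp: "finite (block_pairs (B j) (d - k) p)" for j
    by (rule finite_subset) (simp add: B)
  have fin_A: "finite (A j)" for j
    by (simp add: A_def B)
  have cA: "card (A j) = (d choose k) * (((d * r) choose p) - (d choose p))" if "j < r" for j
  proof -
    have "card ({S. S \<subseteq> {1..r * d} \<and> card S = p} - {S. S \<subseteq> B j \<and> card S = p}) =
        ((r * d) choose p) - (d choose p)"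
      using Bsub[OF that] by (subst card_Diff_subset) (auto simp: n_subsets B)
    then show ?thesis
      using assms by (simp add: A_def card_cartesian_product n_subsets B mult.commute
          flip: binomial_symmetric)
  qed
  have finW: "finite W"
    by (simp add: W_def fin_A fin_bp)
  have "koszul (sum_of_products r d) (basis_vec b) \<in> cvs.span W"
    if b_in: "b \<in> sym_ext_basis (r * d) k p" for b
  proof -
    obtain g S where b: "b = (g, S)" "g \<in> exps {1..r * d} k" "S \<subseteq> {1..r * d}" "card S = p"
      using b_in by (cases b) (auto simp: sym_ext_basis_def subsets_of_card_def)
    have "koszul (basis_vec (sqfree_exp (B j))) (basis_vec b) \<in> cvs.span W" if j: "j < r" for j
    proof -
      have "(\<lambda>U. ext_deriv (basis_vec (sqfree_exp U, S))) ` {U. U \<subseteq> B j \<and> card U = d - k} \<subseteq> cvs.span W"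
      proof safe
        fix U assume U: "U \<subseteq> B j" "card U = d - k"
        show "ext_deriv (basis_vec (sqfree_exp U, S)) \<in> cvs.span W"
        proof (cases "S \<subseteq> B j")
          case True
          have "?E ` block_pairs (B j) (card U) (card S) \<subseteq> W"
            using U b j by (auto simp: W_def)
          then have "cvs.span (?E ` block_pairs (B j) (card U) (card S)) \<subseteq> cvs.span W"
            by (rule cvs.span_mono)
          then show ?thesis
            using ext_deriv_in_span_block_pairs[OF B(1) U(1) True] by auto
        next
          case False
          then have "(U, S) \<in> A j"
            using U b by (auto simp: A_def)
          then have "?E (U, S) \<in> W"
            using j unfolding W_def by blast
          then show ?thesis
            by (simp add: cvs.span_base)
        qed
      qed
      then have "cvs.span ((\<lambda>U. ext_deriv (basis_vec (sqfree_exp U, S))) ` {U. U \<subseteq> B j \<and> card U = d - k})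
          \<subseteq> cvs.span W"
        by (intro cvs.span_minimal) simp_all
      then show ?thesis
        using koszul_sqfree_in_span[OF B(1) B(2) b(2), of j S] by (auto simp: b(1))
    qed
    then show ?thesis
      unfolding sum_of_products_eq B_def[symmetric] lin_sum[OF koszul_basis_lin]
      by (intro cvs.span_sum) simp
  qed
  then have "koszul_rank (r * d) k p (sum_of_products r d) \<le> card W"
    using finW by (intro koszul_rank_le)
  also have "\<dots> \<le> (\<Sum>j<r. card (?E ` (A j \<union> block_pairs (B j) (d - k) p)))"
    unfolding W_def by (rule card_UN_le) simp
  also have "\<dots> \<le> (\<Sum>j<r. (d choose k) * (((d * r) choose p) - (d choose p)) + S_num p d k)"
  proof (rule sum_mono)
    fix j assume j: "j \<in> {..<r}"
    have "card (?E ` (A j \<union> block_pairs (B j) (d - k) p)) \<le> card (A j \<union> block_pairs (B j) (d - k) p)"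
      by (intro card_image_le) (simp add: fin_A fin_bp)
    also have "\<dots> \<le> card (A j) + card (block_pairs (B j) (d - k) p)"
      by (rule card_Un_le)
    also have "\<dots> \<le> (d choose k) * (((d * r) choose p) - (d choose p)) + S_num p d k"
      using cA j card_block_pairs_le[OF B assms] by (simp add: add_mono)
    finally show "card (?E ` (A j \<union> block_pairs (B j) (d - k) p))
        \<le> (d choose k) * (((d * r) choose p) - (d choose p)) + S_num p d k" .
  qed
  finally show ?thesis
    by simp
qed


section \<open>The case \<open>k = p = 1\<close> for products of arbitrary linear forms\<close>

lemma partial_leibniz:
  "partial i (lin_form l * f) = cscale (Poly_Mapping.lookup l i) f + lin_form l * partial i f"
proof -
  have 1: "partial i (lin_form (basis_vec j) * basis_vec m) =
      cscale (Poly_Mapping.lookup (basis_vec j) i) (basis_vec m) +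
      lin_form (basis_vec j) * partial i (basis_vec m)" for j m
  proof -
    \<comment> \<open>Truncated subtraction can break this identity when \<open>x_i\<close> does not
      divide the monomial, but then its derivative is 0.\<close>
    have d: "Poly_Mapping.single j 1 + (m - Poly_Mapping.single i 1) =
        Poly_Mapping.single j 1 + m - Poly_Mapping.single i 1" if "Poly_Mapping.lookup m i \<noteq> 0"
      using that by (intro poly_mapping_eqI) (auto simp: lookup_add lookup_minus lookup_single when_def)
    have "Poly_Mapping.lookup (basis_vec j) i = (if i = j then 1 else 0)"
      by (simp add: basis_vec_def lookup_single when_def)
    moreover have "lin_form (basis_vec j) = basis_vec (Poly_Mapping.single j 1)"
      by (simp add: lin_form_def)
    ultimately show ?thesis
      using d by (cases "Poly_Mapping.lookup m i = 0")
        (auto simp: basis_vec_mult partial_basis lookup_add lin_scale[OF mult_lin_right]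
          lookup_single when_def cvs.scale_left_distrib)
  qed
  have c: "lin (\<lambda>l. cscale (Poly_Mapping.lookup l i) f)" for f :: "(nat \<Rightarrow>\<^sub>0 nat) \<Rightarrow>\<^sub>0 complex"
    by (rule linI) (simp_all add: lookup_add cvs.scale_left_distrib)
  have 2: "partial i (lin_form (basis_vec j) * f) =
      cscale (Poly_Mapping.lookup (basis_vec j) i) f + lin_form (basis_vec j) * partial i f" for j
    by (rule lin_eq_on_basis[where v = f])
      (intro lin_plus lin_compose[OF partial_lin] lin_compose[OF mult_lin_right] mult_lin_right
        partial_lin cscale_lin 1)+
  show ?thesis
    by (rule lin_eq_on_basis[where v = l])
      (intro lin_plus lin_compose[OF partial_lin] lin_compose[OF mult_lin_left] lin_form_lin c 2)+
qed

lemma partial_prod: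
  fixes q :: nat
  shows "partial i (\<Prod>s<q. lin_form (l s)) =
    (\<Sum>s<q. cscale (Poly_Mapping.lookup (l s) i) (\<Prod>t\<in>{..<q} - {s}. lin_form (l t)))"
proof (induction q)
  case 0
  show ?case
    using partial_basis[of i 0] by (simp add: basis_vec_def)
next
  case (Suc q)
  have "(\<Prod>t\<in>{..<Suc q} - {s}. lin_form (l t)) =
      lin_form (l q) * (\<Prod>t\<in>{..<q} - {s}. lin_form (l t))" if "s < q" for s
  proof -
    have "{..<Suc q} - {s} = insert q ({..<q} - {s})"
      using that by auto
    then show ?thesis
      by simp
  qed
  moreover have "{..<Suc q} - {q} = {..<q}"
    by auto
  moreover have "(\<Prod>s<Suc q. lin_form (l s)) = lin_form (l q) * (\<Prod>s<q. lin_form (l s))"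
    by (simp add: mult.commute)
  ultimately show ?case
    by (simp del: prod.lessThan_Suc add: partial_leibniz Suc.IH sum_distrib_left
        lin_scale[OF mult_lin_right] add.commute)
qed

lemma sym_ext_basis_1_1E:
  assumes "b \<in> sym_ext_basis n 1 1"
  obtains i a where "b = (Poly_Mapping.single i 1, {a})" "a \<in> {1..n}"
proof -
  obtain g S where b: "b = (g, S)" "g \<in> exps {1..n} 1" "S \<subseteq> {1..n}" "card S = 1"
    using assms by (cases b) (auto simp: sym_ext_basis_def subsets_of_card_def)
  obtain a where a: "S = {a}"
    using b(4) by (rule card_1_singletonE)
  obtain i where "i \<in> Poly_Mapping.keys g" "Poly_Mapping.lookup g i = 1"
    "\<forall>j\<in>Poly_Mapping.keys g. i \<noteq> j \<longrightarrow> Poly_Mapping.lookup g j = 0"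
    using b(2) unfolding exps_def by (auto simp only: sum_eq_1_iff finite_keys mem_Collect_eq)
  then have "g = Poly_Mapping.single i 1"
    by (intro poly_mapping_eqI) (auto simp: lookup_single when_def in_keys_iff)
  then show ?thesis
    using a b that by auto
qed

lemma wedge_left_one:
  assumes "l \<in> Vsp n"
  shows "wedge_left l (basis_vec {}) = (\<Sum>a\<in>{1..n}. cscale (Poly_Mapping.lookup l a) (basis_vec {a}))"
proof -
  have "wedge_basis a {} = basis_vec {a}" for a
    by (simp add: wedge_basis_def basis_vec_def)
  then show ?thesis
    using assms unfolding wedge_left_def
    by (subst lin_ext_superset[of "{1..n}"]) (auto simp: Vsp_def free_vs_def)
qed

text \<open>By the product rule each partial derivative of the product is a combination of the
  products with one factor removed, so one set \<open>W\<close> serves all \<open>b\<close>.\<close>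

lemma koszul_product_span:
  assumes "0 < d" "\<And>i. i < d \<Longrightarrow> l i \<in> Vsp n" "l 0 \<noteq> 0"
  shows "\<exists>W. finite W \<and> card W \<le> d * n - 1 \<and>
    (\<forall>b\<in>sym_ext_basis n 1 1. koszul (\<Prod>i<d. lin_form (l i)) (basis_vec b) \<in> cvs.span W)"
proof -
  define E where "E i a = ext_deriv (tensor (\<Prod>t\<in>{..<d} - {i}. lin_form (l t)) (basis_vec {a}))" for i a
  \<comment> \<open>A nonzero coordinate of \<open>l 0\<close>, so that the relation can be solved
    for \<open>E 0 a\<close>, the vector left out of \<open>W\<close>.\<close>
  obtain a where a: "Poly_Mapping.lookup (l 0) a \<noteq> 0"
    using assms(3) by (metis poly_mapping_eqI lookup_zero)
  let ?I = "{..<d} \<times> {1..n}"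
  define W where "W = (\<lambda>(i, a). E i a) ` (?I - {(0, a)})"
  have aI: "(0, a) \<in> ?I"
    using a assms by (fastforce simp: Vsp_def free_vs_def in_keys_iff)
  \<comment> \<open>\<open>basis_vec {}\<close> is the unit of the exterior algebra, so this is the
    relation for the product itself.\<close>
  have "0 = ext_deriv (ext_deriv (tensor (\<Prod>i<d. lin_form (l i)) (basis_vec {})))"
    by (simp add: ext_deriv_ext_deriv_tensor)
  also have "\<dots> = (\<Sum>i<d. \<Sum>a\<in>{1..n}. cscale (Poly_Mapping.lookup (l i) a) (E i a))"
    using assms(2) by (simp add: ext_deriv_prod wedge_left_one[of _ n] E_def lin_sum[OF ext_deriv_lin]
        lin_scale[OF ext_deriv_lin] lin_sum[OF tensor_lin_right] lin_scale[OF tensor_lin_right] cong: sum.cong_simp)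
  also have "\<dots> = (\<Sum>(i, a)\<in>?I. cscale (Poly_Mapping.lookup (l i) a) (E i a))"
    by (rule sum.cartesian_product)
  also have "\<dots> = cscale (Poly_Mapping.lookup (l 0) a) (E 0 a) +
      (\<Sum>(i, a)\<in>?I - {(0, a)}. cscale (Poly_Mapping.lookup (l i) a) (E i a))"
    using aI by (subst sum.remove[of ?I "(0, a)"]) auto
  finally have "cscale (Poly_Mapping.lookup (l 0) a) (E 0 a) =
      - (\<Sum>(i, a)\<in>?I - {(0, a)}. cscale (Poly_Mapping.lookup (l i) a) (E i a))"
    by (simp add: eq_neg_iff_add_eq_0)
  also have "\<dots> \<in> cvs.span W"
  proof (intro cvs.span_neg cvs.span_sum)
    fix x assume "x \<in> ?I - {(0, a)}"
    then have "(case x of (i, a) \<Rightarrow> E i a) \<in> cvs.span W"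
      unfolding W_def by (intro cvs.span_base imageI)
    then show "(case x of (i, a) \<Rightarrow> cscale (Poly_Mapping.lookup (l i) a) (E i a)) \<in> cvs.span W"
      by (cases x) (simp add: cvs.span_scale)
  qed
  finally have "cscale (inverse (Poly_Mapping.lookup (l 0) a))
      (cscale (Poly_Mapping.lookup (l 0) a) (E 0 a)) \<in> cvs.span W"
    by (rule cvs.span_scale)
  then have E0: "E 0 a \<in> cvs.span W"
    using a by simp
  have E: "E i b \<in> cvs.span W" if "i < d" "b \<in> {1..n}" for i b
  proof (cases "(i, b) = (0, a)")
    case False
    then have "E i b \<in> W"
      using that unfolding W_def by (intro image_eqI[where x = "(i, b)"]) auto
    then show ?thesis
      by (rule cvs.span_base)
  qed (use E0 in auto)
  show ?thesis
  proof (intro exI[of _ W] conjI ballI)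
    show "finite W"
      by (simp add: W_def)
    show "card W \<le> d * n - 1"
      unfolding W_def using aI by (intro order.trans[OF card_image_le]) (simp_all add: card_Diff_singleton)
    fix b assume "b \<in> sym_ext_basis n 1 1"
    then obtain i a where b: "b = (Poly_Mapping.single i 1, {a})" "a \<in> {1..n}"
      by (rule sym_ext_basis_1_1E)
    have "koszul (\<Prod>i<d. lin_form (l i)) (basis_vec b) =
        (\<Sum>s<d. cscale (Poly_Mapping.lookup (l s) i) (E s a))"
      by (simp add: b koszul_basis diff_monom_def partial_prod E_def lin_sum[OF tensor_lin_left]
          lin_scale[OF tensor_lin_left] lin_sum[OF ext_deriv_lin] lin_scale[OF ext_deriv_lin])
    also have "\<dots> \<in> cvs.span W"
      using E b by (intro cvs.span_sum cvs.span_scale) auto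
    finally show "koszul (\<Prod>i<d. lin_form (l i)) (basis_vec b) \<in> cvs.span W" .
  qed
qed

lemma lin_span_in_span:
  assumes "lin F" "\<And>s. s \<in> S \<Longrightarrow> F s \<in> cvs.span W" "z \<in> cvs.span S"
  shows "F z \<in> cvs.span W"
proof -
  have "cvs.subspace {z. F z \<in> cvs.span W}"
    using assms(1) by (auto simp: cvs.subspace_def lin_add lin_scale lin_zero cvs.span_zero
        cvs.span_add cvs.span_scale)
  then have "cvs.span S \<subseteq> {z. F z \<in> cvs.span W}"
    using assms(2) by (intro cvs.span_minimal) auto
  then show ?thesis
    using assms(3) by auto
qed

text \<open>\<open>W\<close> is fixed by the \<open>r\<close> products alone and works for every
  \<open>z\<close> in their span, as needed both for one sum and for all points of a secant
  space.\<close>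

lemma koszul_products_span:
  assumes "0 < d" "\<And>j i. j < r \<Longrightarrow> i < d \<Longrightarrow> w j i \<in> Vsp n" "\<And>j. j < r \<Longrightarrow> w j 0 \<noteq> 0"
  shows "\<exists>W. finite W \<and> card W \<le> r * (d * n - 1) \<and>
    (\<forall>z\<in>cvs.span ((\<lambda>j. \<Prod>i<d. lin_form (w j i)) ` {..<r}). \<forall>b\<in>sym_ext_basis n 1 1.
      koszul z (basis_vec b) \<in> cvs.span W)"
proof -
  have "\<forall>j\<in>{..<r}. \<exists>W. finite W \<and> card W \<le> d * n - 1 \<and>
    (\<forall>b\<in>sym_ext_basis n 1 1. koszul (\<Prod>i<d. lin_form (w j i)) (basis_vec b) \<in> cvs.span W)"
    using koszul_product_span[of d _ n] assms by simp
  then obtain W where W: "\<And>j. j < r \<Longrightarrow> finite (W j)" "\<And>j. j < r \<Longrightarrow> card (W j) \<le> d * n - 1"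
    "\<And>j b. j < r \<Longrightarrow> b \<in> sym_ext_basis n 1 1 \<Longrightarrow>
       koszul (\<Prod>i<d. lin_form (w j i)) (basis_vec b) \<in> cvs.span (W j)"
    by (auto dest!: bchoice)
  show ?thesis
  proof (intro exI[of _ "\<Union>j<r. W j"] conjI ballI)
    show "finite (\<Union>j<r. W j)"
      using W by auto
    have "card (\<Union>j<r. W j) \<le> (\<Sum>j<r. card (W j))"
      by (rule card_UN_le) simp
    also have "\<dots> \<le> r * (d * n - 1)"
      using sum_bounded_above[of "{..<r}" "\<lambda>j. card (W j)" "d * n - 1"] W by simp
    finally show "card (\<Union>j<r. W j) \<le> r * (d * n - 1)" .
    fix z b
    assume z: "z \<in> cvs.span ((\<lambda>j. \<Prod>i<d. lin_form (w j i)) ` {..<r})" and b: "b \<in> sym_ext_basis n 1 1"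
    have "koszul (\<Prod>i<d. lin_form (w j i)) (basis_vec b) \<in> cvs.span (\<Union>j<r. W j)" if "j < r" for j
      using W(3)[OF that b] cvs.span_mono[of "W j" "\<Union>j<r. W j"] that by auto
    then show "koszul z (basis_vec b) \<in> cvs.span (\<Union>j<r. W j)"
      by (intro lin_span_in_span[OF koszul_basis_lin _ z]) auto
  qed
qed

text \<open>The variables are taken as the linear forms, so the bound follows from the redundancy
  relation without evaluating \<open>S_num\<close>.\<close>

lemma koszul_rank_1_1_sum_of_products:
  assumes "0 < d"
  shows "koszul_rank (r * d) 1 1 (sum_of_products r d) \<le> r * (d * (r * d) - 1)"
proof -
  define w where "w j i = (basis_vec (j * d + Suc i) :: nat \<Rightarrow>\<^sub>0 complex)" for j i
  have w: "w j i \<in> Vsp (r * d)" if "j < r" "i < d" for j i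
  proof -
    have "(j + 1) * d \<le> r * d"
      using that by (intro mult_right_mono) auto
    then show ?thesis
      using that by (simp add: w_def Vsp_def free_vs_def basis_vec_def)
  qed
  have "w j 0 \<noteq> 0" for j
  proof -
    have "Poly_Mapping.lookup (w j 0) (j * d + 1) = 1"
      by (simp add: w_def basis_vec_def)
    then show ?thesis
      by auto
  qed
  then obtain W where W: "finite W" "card W \<le> r * (d * (r * d) - 1)"
    "\<forall>z\<in>cvs.span ((\<lambda>j. \<Prod>i<d. lin_form (w j i)) ` {..<r}). \<forall>b\<in>sym_ext_basis (r * d) 1 1.
       koszul z (basis_vec b) \<in> cvs.span W"
    using koszul_products_span[of d r w "r * d"] assms w by auto
  have "sum_of_products r d = (\<Sum>j<r. \<Prod>i<d. lin_form (w j i))"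
    by (simp add: sum_of_products_def sym_var_def w_def prod.atLeast1_atMost_eq)
  also have "\<dots> \<in> cvs.span ((\<lambda>j. \<Prod>i<d. lin_form (w j i)) ` {..<r})"
    by (intro cvs.span_sum cvs.span_base imageI)
  finally have "koszul_rank (r * d) 1 1 (sum_of_products r d) \<le> card W"
    using W by (intro koszul_rank_le) auto
  then show ?thesis
    using W(2) by (rule order.trans)
qed

section \<open>Minors\<close>

text \<open>A linear dependency among the \<open>v j\<close> is a nonzero kernel vector of the
  matrix whose columns are coordinates of the \<open>v j\<close>.\<close>

lemma det_zero_of_small_span:
  fixes v :: "nat \<Rightarrow> ('b \<Rightarrow>\<^sub>0 complex)"
  assumes "finite W" "card W < N" "\<And>j. j < N \<Longrightarrow> v j \<in> cvs.span W"
  shows "det (mat N N (\<lambda>(i, j). Poly_Mapping.lookup (v j) (bs ! i))) = 0"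
proof -
  obtain a where a: "\<exists>j<N. a j \<noteq> 0" "(\<Sum>j<N. cscale (a j) (v j)) = 0"
  proof (cases "inj_on v {..<N}")
    case True
    have "cvs.dependent (v ` {..<N})"
      using cvs.independent_span_bound[of W "v ` {..<N}"] assms True by (auto simp: card_image)
    then obtain u where "\<exists>x\<in>v ` {..<N}. u x \<noteq> 0" "(\<Sum>x\<in>v ` {..<N}. cscale (u x) x) = 0"
      by (auto simp: cvs.dependent_finite)
    then show ?thesis
      using True by (intro that[of "\<lambda>j. u (v j)"]) (auto simp: sum.reindex)
  next
    case False
    then obtain i j where ij: "i < N" "j < N" "i \<noteq> j" "v i = v j"
      by (auto simp: inj_on_def)
    have "(\<Sum>k<N. cscale ((if k = i then 1 else 0) - (if k = j then 1 else 0)) (v k)) = v i - v j"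
      using ij by (simp add: cvs.scale_left_diff_distrib sum_subtractf if_distrib[of "\<lambda>c. cscale c _"]
          cong: if_cong)
    then show ?thesis
      using ij by (intro that[of "\<lambda>k. (if k = i then 1 else 0) - (if k = j then 1 else 0)"]) auto
  qed
  let ?A = "mat N N (\<lambda>(i, j). Poly_Mapping.lookup (v j) (bs ! i))"
  have "vec N a \<noteq> 0\<^sub>v N"
    using a(1) by (metis index_vec index_zero_vec(1))
  moreover have "?A *\<^sub>v vec N a = 0\<^sub>v N"
  proof (rule eq_vecI)
    fix i assume "i < dim_vec (0\<^sub>v N :: complex vec)"
    then have "(?A *\<^sub>v vec N a) $ i = (\<Sum>j<N. Poly_Mapping.lookup (v j) (bs ! i) * a j)"
      by (simp add: scalar_prod_def atLeast0LessThan)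
    also have "\<dots> = Poly_Mapping.lookup (\<Sum>j<N. cscale (a j) (v j)) (bs ! i)"
      by (simp add: lookup_sum mult.commute)
    finally show "(?A *\<^sub>v vec N a) $ i = 0\<^sub>v N $ i"
      using a(2) \<open>i < _\<close> by simp
  qed simp
  ultimately show ?thesis
    by (subst det_0_iff_vec_prod_zero[of _ N]) (auto intro!: exI[of _ "vec N a"])
qed

section \<open>Homogeneity of the minors and vanishing on secants\<close>

lemma subspace_free_vs: "cvs.subspace (free_vs B)"
  by (auto simp: cvs.subspace_def free_vs_def in_keys_iff lookup_add) (metis add.right_neutral subsetD in_keys_iff)

lemma exps_add:
  assumes "m \<in> exps A a" "m' \<in> exps A b"
  shows "m + m' \<in> exps A (a + b)"
proof -
  let ?K = "Poly_Mapping.keys m \<union> Poly_Mapping.keys m'"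
  have deg: "(\<Sum>x\<in>Poly_Mapping.keys u. Poly_Mapping.lookup u x) = (\<Sum>x\<in>?K. Poly_Mapping.lookup u x)"
    if "Poly_Mapping.keys u \<subseteq> ?K" for u
    using that by (intro sum.mono_neutral_left) (auto simp: in_keys_iff)
  have "(\<Sum>x\<in>Poly_Mapping.keys (m + m'). Poly_Mapping.lookup (m + m') x) =
      (\<Sum>x\<in>?K. Poly_Mapping.lookup m x) + (\<Sum>x\<in>?K. Poly_Mapping.lookup m' x)"
    by (subst deg[OF keys_add]) (simp add: lookup_add sum.distrib)
  also have "\<dots> = a + b"
    using assms by (simp add: exps_def deg[symmetric])
  finally show ?thesis
    using assms keys_add[of m m'] by (auto simp: exps_def)
qed

lemma free_vs_exps_mult:
  assumes "F \<in> free_vs (exps A a)" "G \<in> free_vs (exps A b)"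
  shows "F * G \<in> free_vs (exps A (a + b))"
  unfolding free_vs_def
proof safe
  fix m assume "m \<in> Poly_Mapping.keys (F * G)"
  then obtain m1 m2 where "m = m1 + m2" "m1 \<in> Poly_Mapping.keys F" "m2 \<in> Poly_Mapping.keys G"
    using keys_mult[of F G] by auto
  then show "m \<in> exps A (a + b)"
    using assms by (auto simp: free_vs_def intro: exps_add)
qed

lemma free_vs_exps_prod:
  assumes "finite I" "\<And>i. i \<in> I \<Longrightarrow> F i \<in> free_vs (exps A 1)"
  shows "(\<Prod>i\<in>I. F i) \<in> free_vs (exps A (card I))"
  using assms
proof (induction I rule: finite_induct)
  case empty
  show ?case
    by (auto simp: free_vs_def exps_def)
next
  case (insert i I)
  then show ?case
    using free_vs_exps_mult[of "F i" A 1 "\<Prod>i\<in>I. F i" "card I"] by simp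
qed

text \<open>Zariski closed sets are defined by homogeneous polynomials only. Each term of the
  Leibniz expansion is a signed product of \<open>N\<close> linear forms.\<close>

lemma koszul_minor_homogeneous:
  assumes "length bs = N" "length cs = N"
  shows "koszul_minor n d bs cs \<in> free_vs (exps (exps {1..n} d) N)"
proof -
  let ?B = "exps {1..n} d"
  have entry: "koszul_entry_poly n d b c \<in> free_vs (exps ?B 1)" for b c
    unfolding koszul_entry_poly_def
    by (intro cvs.subspace_sum subspace_free_vs) (auto simp: free_vs_def exps_def)
  have "signof p * (\<Prod>i = 0..<N. koszul_entry_poly n d (bs ! i) (cs ! p i)) \<in> free_vs (exps ?B N)"
    for p
  proof -
    have "(\<Prod>i = 0..<N. koszul_entry_poly n d (bs ! i) (cs ! p i)) \<in> free_vs (exps ?B N)"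
      using free_vs_exps_prod[of "{0..<N}" _ ?B] entry by simp
    then show ?thesis
      using cvs.subspace_neg[OF subspace_free_vs] by (auto simp: sign_def)
  qed
  moreover have "(\<Prod>i = 0..<N. mat N N (\<lambda>(i, j). koszul_entry_poly n d (bs ! i) (cs ! j)) $$ (i, p i)) =
      (\<Prod>i = 0..<N. koszul_entry_poly n d (bs ! i) (cs ! p i))" if "p permutes {0..<N}" for p
    using permutes_in_image[OF that] by (intro prod.cong) auto
  ultimately show ?thesis
    unfolding koszul_minor_def det_def
    by (auto simp: assms intro!: cvs.subspace_sum subspace_free_vs)
qed

text \<open>The columns of the evaluated minor are coordinates of vectors in the span of one set
  \<open>W\<close> with fewer than \<open>N\<close> elements.\<close>

lemma koszul_minor_vanishes_on_secants:
  assumes "0 < d" "length ps = r" "set ps \<subseteq> Chow n d" "z \<in> cvs.span (\<Union>(set ps))" "z \<in> Sym n d"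
    "length bs = N" "length cs = N" "set cs \<subseteq> sym_ext_basis n 1 1" "r * (d * n - 1) < N"
  shows "peval (koszul_minor n d bs cs) z = 0"
proof -
  have "\<forall>j\<in>{..<r}. \<exists>w. ps ! j = cvs.span {\<Prod>i<d. lin_form (w i)} \<and> (\<forall>i<d. w i \<in> Vsp n) \<and>
      (\<Prod>i<d. lin_form (w i)) \<noteq> 0"
  proof
    fix j assume "j \<in> {..<r}"
    then have "ps ! j \<in> Chow n d"
      using assms by auto
    then show "\<exists>w. ps ! j = cvs.span {\<Prod>i<d. lin_form (w i)} \<and> (\<forall>i<d. w i \<in> Vsp n) \<and>
      (\<Prod>i<d. lin_form (w i)) \<noteq> 0"
      unfolding Chow_def by blast
  qed
  then obtain w where w: "\<And>j. j < r \<Longrightarrow> ps ! j = cvs.span {\<Prod>i<d. lin_form (w j i)}"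
    "\<And>j i. j < r \<Longrightarrow> i < d \<Longrightarrow> w j i \<in> Vsp n" "\<And>j. j < r \<Longrightarrow> (\<Prod>i<d. lin_form (w j i)) \<noteq> 0"
    by (auto dest!: bchoice)
  \<comment> \<open>Points of the Chow variety come from nonzero products, whose factors are
    nonzero.\<close>
  have "w j 0 \<noteq> 0" if "j < r" for j
  proof
    assume "w j 0 = 0"
    then have "lin_form (w j 0) = 0"
      by (simp add: lin_zero[OF lin_form_lin])
    then have "(\<Prod>i<d. lin_form (w j i)) = 0"
      using assms(1) by (intro prod_zero) auto
    then show False
      using w(3)[OF that] by simp
  qed
  then obtain W where W: "finite W" "card W \<le> r * (d * n - 1)"
    "\<forall>z\<in>cvs.span ((\<lambda>j. \<Prod>i<d. lin_form (w j i)) ` {..<r}). \<forall>b\<in>sym_ext_basis n 1 1.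
       koszul z (basis_vec b) \<in> cvs.span W"
    using koszul_products_span[of d r w n] assms(1) w(2) by auto
  have "\<Union>(set ps) \<subseteq> cvs.span ((\<lambda>j. \<Prod>i<d. lin_form (w j i)) ` {..<r})"
  proof
    fix x assume "x \<in> \<Union>(set ps)"
    then obtain j where "j < r" "x \<in> ps ! j"
      using assms(2) by (auto simp: in_set_conv_nth)
    then have "x \<in> cvs.span {\<Prod>i<d. lin_form (w j i)}"
      using w(1) by simp
    then show "x \<in> cvs.span ((\<lambda>j. \<Prod>i<d. lin_form (w j i)) ` {..<r})"
      using cvs.span_mono[of "{\<Prod>i<d. lin_form (w j i)}" "(\<lambda>j. \<Prod>i<d. lin_form (w j i)) ` {..<r}"] \<open>j < r\<close>
      by auto
  qed
  then have z: "z \<in> cvs.span ((\<lambda>j. \<Prod>i<d. lin_form (w j i)) ` {..<r})"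
    using assms(4) cvs.span_minimal[OF _ cvs.subspace_span] by blast
  have "koszul z (basis_vec (cs ! j)) \<in> cvs.span W" if "j < N" for j
  proof -
    have "cs ! j \<in> sym_ext_basis n 1 1"
      using assms(7,8) that nth_mem by blast
    then show ?thesis
      using W(3) z by blast
  qed
  then have "det (mat N N (\<lambda>(i, j). Poly_Mapping.lookup (koszul z (basis_vec (cs ! j))) (bs ! i))) = 0"
    using W assms(9) by (intro det_zero_of_small_span) auto
  then show ?thesis
    using assms(5-7) by (simp add: peval_koszul_minor koszul_entry_def)
qed

text \<open>The zero locus of a minor is closed and contains every span of \<open>r\<close> points,
  hence it contains the closure of their union.\<close>

lemma koszul_minors_vanish_on_secant_variety:
  assumes "0 < d" "r * (d * n - 1) < N"
  shows "koszul_minors n d 1 1 N \<subseteq>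
    vanishing_ideal (exps {1..n} d) (secant_variety (exps {1..n} d) r (Chow n d))"
proof
  let ?B = "exps {1..n} d"
  fix F assume "F \<in> koszul_minors n d 1 1 N"
  then obtain bs cs where F: "F = koszul_minor n d bs cs" "length bs = N" "length cs = N"
    "set cs \<subseteq> sym_ext_basis n 1 1"
    by (auto simp: koszul_minors_def)
  have hom: "F \<in> free_vs (exps ?B N)"
    using koszul_minor_homogeneous[OF F(2,3)] F(1) by simp
  have "zariski_closed ?B (zero_locus ?B {F})"
    unfolding zariski_closed_def using hom by (intro exI[of _ "{F}"] conjI refl) auto
  moreover have "proj_span ?B (set ps) \<subseteq> zero_locus ?B {F}"
    if ps: "length ps = r" "set ps \<subseteq> Chow n d" for ps
  proof
    fix L assume "L \<in> proj_span ?B (set ps)"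
    then have L: "L \<in> proj_space ?B" "L \<subseteq> cvs.span (\<Union>(set ps))"
      by (auto simp: proj_span_def)
    obtain z0 where "L = cvs.span {z0}" "z0 \<in> free_vs ?B"
      using L(1) by (auto simp: proj_space_def)
    then have "L \<subseteq> Sym n d"
      using cvs.span_minimal[OF _ subspace_free_vs, of "{z0}" ?B] by (simp add: Sym_def)
    then have "peval F z = 0" if "z \<in> L" for z
      using koszul_minor_vanishes_on_secants[OF assms(1) ps _ _ F(2-4) assms(2)] L that F(1) by blast
    then show "L \<in> zero_locus ?B {F}"
      using L by (simp add: zero_locus_def)
  qed
  ultimately have "secant_variety ?B r (Chow n d) \<subseteq> zero_locus ?B {F}"
    unfolding secant_variety_def zariski_closure_def by blast
  moreover have "F \<in> poly_ring ?B"
    using hom unfolding poly_ring_def free_vs_def exps_def[of ?B] by blast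
  ultimately show "F \<in> vanishing_ideal ?B (secant_variety ?B r (Chow n d))"
    by (auto simp: vanishing_ideal_def zero_locus_def)
qed

theorem theorem1p5:
  fixes d r :: nat
  assumes "r \<ge> 2"
  shows "(\<forall>k p. 1 \<le> k \<and> k < d \<and> 1 \<le> p \<and> p < d \<longrightarrow>
           koszul_rank (r * d) k p (sum_of_products r d)
             \<le> r * ((d choose k) * (((d * r) choose p) - (d choose p)) + S_num p d k)) \<and>
         (d \<ge> 2 \<longrightarrow>
           koszul_rank (r * d) 1 1 (sum_of_products r d) \<le> d\<^sup>2 * r\<^sup>2 - r) \<and>
         (d \<ge> 2 \<longrightarrow>
           koszul_minors (r * d) d 1 1 (d\<^sup>2 * r\<^sup>2 - r + 1)
             \<subseteq> vanishing_ideal (exps {1..r * d} d)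
                 (secant_variety (exps {1..r * d} d) r (Chow (r * d) d)))"
proof -
  \<comment> \<open>The span bound at n = r d; minors of size one larger meet the strict inequality
    required for vanishing.\<close>
  have bound: "r * (d * (r * d) - 1) = d\<^sup>2 * r\<^sup>2 - r"
    by (simp add: diff_mult_distrib2 power2_eq_square mult_ac)
  show ?thesis
    using koszul_rank_sum_of_products[of _ d r] koszul_rank_1_1_sum_of_products[of d r]
      koszul_minors_vanish_on_secant_variety[of d r "r * d" "d\<^sup>2 * r\<^sup>2 - r + 1"]
    unfolding bound by (auto simp del: One_nat_def)
qed

end
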